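(* Under Assumptions (S1), (S2), (S3) below, suppose $H_0: X\perp Y\mid Z$ holds and $n=n(m)$ satisfies $n\to\infty$ and $n=o(m^{\gamma/2})$ as $m\to\infty$. Then, uniformly over $P\in\mathcal P_0$, $$\mathbb E_P[\varphi^{\mathrm{RESIT}}_\alpha(\mathcal D^{(n)}_{te},\mathcal D^{(m)}_{tr})]\le\alpha+\min\big\{d_{TV}(P^n_{\epsilon^*,\eta^*},P^n_{\epsilon,\eta^*}),\,d_{TV}(P^n_{\epsilon^*,\eta^*},P^n_{\epsilon^*,\eta})\big\}+o(1),$$ meaning $\limsup_{m\to\infty}\sup_{P\in\mathcal P_0}\big(\mathbb E_P[\varphi^{\mathrm{RESIT}}_\alpha]-\alpha-\min\{\cdots\}\big)\le0$.
   Context: Setting. Data: i.i.d. $(X_i,Y_i,Z_i)\sim P$, $i=1,\dots,n+m$, split into test set $\mathcal D^{(n)}_{te}$ (indices $1..n$) and training set $\mathcal D^{(m)}_{tr}$ (indices $n+1..n+m$). $\mathcal P_0$ is the set of distributions in the model family under which $X\perp Y\mid Z$. Additive noise model: $X=f^*_{1,P}(Z)+\epsilon$, $Y=f^*_{2,P}(Z)+\eta$ with $f^*_{1,P}(Z)=\mathbb E_P[X\mid Z]$, $f^*_{2,P}(Z)=\mathbb E_P[Y\mid Z]$ and $(\epsilon,\eta)$ independent of $Z$; then $X\perp Y\mid Z$ iff $\epsilon\perp\eta$. Models $\hat g^{(m)}_1:\mathcal Z\to\mathbb R^{d_X}$, $\hat g^{(m)}_2:\mathcal Z\to\mathbb R^{d_Y}$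 are fitted on $\mathcal D^{(m)}_{tr}$, with limiting models $g^*_{1,P},g^*_{2,P}$, and $\delta_{j,P}=g^*_{j,P}-f^*_{j,P}$. Residuals on the test set: $\hat\epsilon_i=X_i-\hat g^{(m)}_1(Z_i)$, $\hat\eta_i=Y_i-\hat g^{(m)}_2(Z_i)$. RESIT test: let $(\hat{\boldsymbol\epsilon},\hat{\boldsymbol\eta})$ be the $n\times(d_X+d_Y)$ matrix with rows $(\hat\epsilon_i,\hat\eta_i)$, and for $b=1,\dots,B$ let $(\hat{\boldsymbol\epsilon},\hat{\boldsymbol\eta})^{(b)}$ be obtained by keeping $\hat{\boldsymbol\epsilon}$ fixed and permuting the rows of $\hat{\boldsymbol\eta}$ by a uniformly random permutation $\pi_b$ of $\{1,\dots,n\}$, $\pi_1,\dots,\pi_B$ i.i.d. and independent of the data. For a measurable test statistic $\Psi$, $p=\big(1+\sum_{b=1}^B\mathbf 1[\Psi((\hat{\boldsymbol\epsilon},\hat{\boldsymbol\eta})^{(b)})\ge\Psi((\hat{\boldsymbol\epsilon},\hat{\boldsymbol\eta}))]\big)/(1+B)$ and $\varphi^{\mathrm{RESIT}}_\alpha=1$ if $p\le\alpha$, else $0$. Define $\epsilon^*=\epsilon-\delta_{1,P}(Z)$, $\eta^*=\eta-\delta_{2,P}(Z)$; $P_{\epsilon^*,\eta^*}$, $P_{\epsilon,\eta^*}$, $P_{\epsilon^*,\eta}$ denote the joint laws of the indicated pairs (with $(\epsilon,\eta,Z)$ from one draw of $P$); $Q^n$ is the $n$-fold product of $Q$; $d_{TV}$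 is total variation distance. Uniform order: $V^{(m)}_P=\mathcal O_{\mathcal P_0}(a_m)$ means for every $\varepsilon>0$ there is $M$ with $\sup_m\sup_{P\in\mathcal P_0}\mathbb P_P(|V^{(m)}_P/a_m|>M)<\varepsilon$; $\mathbb E_P[\cdot\mid\mathcal D^{(m)}_{tr}]$ integrates over a fresh $Z\sim P$ with the training set fixed. (S1) There are $g^*_{1,P},g^*_{2,P}$ and $\gamma>0$ with $\mathbb E_P[\|\hat g^{(m)}_j(Z)-g^*_{j,P}(Z)\|_2^2\mid\mathcal D^{(m)}_{tr}]=\mathcal O_{\mathcal P_0}(m^{-\gamma})$, $j=1,2$. (S2) For all $P\in\mathcal P_0$, the law of $(\epsilon,\eta)$ is absolutely continuous w.r.t. Lebesgue measure on $\mathbb R^{d_X}\times\mathbb R^{d_Y}$ with density $p_{\epsilon,\eta}$ that is $L$-Lipschitz: $|p_{\epsilon,\eta}(e_1,h_1)-p_{\epsilon,\eta}(e_2,h_2)|\le L\|(e_1,h_1)-(e_2,h_2)\|_2$, with $L$ not depending on $P$. (S3) There is a bounded Borel set $A\subseteq\mathbb R^{d_X}\times\mathbb R^{d_Y}$ with $\inf_{P\in\mathcal P_0}\mathbb P_P((X,Y)\in A)=1$ and $\inf_{P\in\mathcal P_0}\inf_{g_1,g_2}\mathbb P_P((g_1(Z),g_2(Z))\in A)=1$, where the inner infimum is over all models in the (union over $m$ of the) model classes used for $\hat g^{(m)}_1,\hat g^{(m)}_2$. *)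

theory Defs
  imports "HOL-Probability.Probability" "HOL-Probability.Product_PMF"
    "HOL-Library.Landau_Symbols"
begin

definition tv_dist :: "'a measure \<Rightarrow> 'a measure \<Rightarrow> real" where
  "tv_dist M N = (SUP A \<in> sets M. \<bar>measure M A - measure N A\<bar>)"

text \<open>Law of one observation (X,Y,Z) in the additive noise model:
  Z ~ PZ, (eps,eta) ~ PN independent of Z, X = f1 Z + eps, Y = f2 Z + eta.
  Observations are triples (x, y, z).\<close>
definition anm_law ::
  "'z measure \<Rightarrow> 'z measure \<Rightarrow> ('x::euclidean_space \<times> 'y::euclidean_space) measure
     \<Rightarrow> ('z \<Rightarrow> 'x) \<Rightarrow> ('z \<Rightarrow> 'y) \<Rightarrow> ('x \<times> 'y \<times> 'z) measure" where
  "anm_law MZ PZ PN f1 f2 =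
     distr (PZ \<Otimes>\<^sub>M PN) (borel \<Otimes>\<^sub>M borel \<Otimes>\<^sub>M MZ)
       (\<lambda>(z, e, h). (f1 z + e, f2 z + h, z))"

text \<open>Joint law of (eps - s1 Z, eta - s2 Z) for (eps,eta,Z) from one draw.
  With s1 = delta_1, s2 = delta_2 this is the law of (eps*, eta*);
  with s1 = 0 (resp. s2 = 0) it is the law of (eps, eta*) (resp. (eps*, eta)).\<close>
definition shifted_noise_law ::
  "'z measure \<Rightarrow> ('x::euclidean_space \<times> 'y::euclidean_space) measure
     \<Rightarrow> ('z \<Rightarrow> 'x) \<Rightarrow> ('z \<Rightarrow> 'y) \<Rightarrow> ('x \<times> 'y) measure" where
  "shifted_noise_law PZ PN s1 s2 =
     distr (PZ \<Otimes>\<^sub>M PN) borel (\<lambda>(z, e, h). (e - s1 z, h - s2 z))"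

definition resid_rows ::
  "nat \<Rightarrow> ('z \<Rightarrow> 'x::real_normed_vector) \<Rightarrow> ('z \<Rightarrow> 'y::real_normed_vector)
     \<Rightarrow> (nat \<Rightarrow> 'x \<times> 'y \<times> 'z) \<Rightarrow> nat \<Rightarrow> 'x \<times> 'y" where
  "resid_rows n g1 g2 te =
     (\<lambda>i\<in>{..<n}. (fst (te i) - g1 (snd (snd (te i))), fst (snd (te i)) - g2 (snd (snd (te i)))))"

definition perm_rows :: "nat \<Rightarrow> (nat \<Rightarrow> 'x \<times> 'y) \<Rightarrow> (nat \<Rightarrow> nat) \<Rightarrow> nat \<Rightarrow> 'x \<times> 'y" where
  "perm_rows n R \<pi> = (\<lambda>i\<in>{..<n}. (fst (R i), snd (R (\<pi> i))))"

definition resit_pvalue ::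
  "nat \<Rightarrow> nat \<Rightarrow> ((nat \<Rightarrow> 'x \<times> 'y) \<Rightarrow> real) \<Rightarrow> (nat \<Rightarrow> 'x \<times> 'y) \<Rightarrow> (nat \<Rightarrow> nat \<Rightarrow> nat) \<Rightarrow> real" where
  "resit_pvalue n B \<Psi> R \<pi>s =
     (1 + real (card {b \<in> {..<B}. \<Psi> (perm_rows n R (\<pi>s b)) \<ge> \<Psi> R})) / (1 + real B)"

definition resit_test ::
  "nat \<Rightarrow> nat \<Rightarrow> ((nat \<Rightarrow> 'x \<times> 'y) \<Rightarrow> real) \<Rightarrow> real \<Rightarrow> (nat \<Rightarrow> 'x \<times> 'y) \<Rightarrow> (nat \<Rightarrow> nat \<Rightarrow> nat) \<Rightarrow> real" where
  "resit_test n B \<Psi> \<alpha> R \<pi>s = (if resit_pvalue n B \<Psi> R \<pi>s \<le> \<alpha> then 1 else 0)"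

definition perm_law :: "nat \<Rightarrow> nat \<Rightarrow> (nat \<Rightarrow> nat \<Rightarrow> nat) pmf" where
  "perm_law n B = Pi_pmf {..<B} id (\<lambda>_. pmf_of_set {\<pi>. \<pi> permutes {..<n}})"

definition resit_rejection_prob ::
  "nat \<Rightarrow> nat \<Rightarrow> nat \<Rightarrow> (nat \<Rightarrow> (nat \<Rightarrow> 'x \<times> 'y) \<Rightarrow> real) \<Rightarrow> real
     \<Rightarrow> (nat \<Rightarrow> (nat \<Rightarrow> 'x::real_normed_vector \<times> 'y::real_normed_vector \<times> 'z) \<Rightarrow> 'z \<Rightarrow> 'x)
     \<Rightarrow> (nat \<Rightarrow> (nat \<Rightarrow> 'x \<times> 'y \<times> 'z) \<Rightarrow> 'z \<Rightarrow> 'y)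
     \<Rightarrow> ('x \<times> 'y \<times> 'z) measure \<Rightarrow> real" where
  "resit_rejection_prob n m B \<Psi> \<alpha> g1hat g2hat P =
     (\<integral>d. measure_pmf.expectation (perm_law n B)
            (\<lambda>\<pi>s. resit_test n B (\<Psi> n) \<alpha>
                    (resid_rows n (g1hat m (snd d)) (g2hat m (snd d)) (fst d)) \<pi>s)
       \<partial>(PiM {..<n} (\<lambda>_. P) \<Otimes>\<^sub>M PiM {..<m} (\<lambda>_. P)))"

end

theory Submission
  imports Defs
begin

text \<open>
  Conditionally on the training set, the residual rows are i.i.d. from the law of
  \<open>(\<epsilon> - (g1hat - f1)(Z), \<eta> - (g2hat - f2)(Z))\<close>. Its density is a mixture over \<open>z\<close> of translates
  of the noise density, and so is that of \<open>(\<epsilon>*, \<eta>*)\<close>; as the noise density is Lipschitz and the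
  residuals stay in a fixed ball, integrals of \<open>[0,1]\<close>-valued functions under the two laws differ
  by at most a constant times the \<open>L\<^sup>1\<close> distance between the fitted and the limiting models.
  For \<open>n\<close> rows these errors add up, which gives \<open>O(n m powr (- \<gamma> / 2)) = o(1)\<close> outside a set of
  training sets of small probability.
  Replacing \<open>\<epsilon>*\<close> by \<open>\<epsilon>\<close>, or \<open>\<eta>*\<close> by \<open>\<eta>\<close>, costs the total variation distance and makes the two
  components independent, so that the permutation test is exact up to its level \<open>\<alpha>\<close>.
\<close>

subsection \<open>Ranks under random permutations\<close>

text \<open>The Lipschitz condition controls a difference of densities only pointwise, so the error
  has to be integrated over a set of finite volume. A fitted residual is the difference of
  \<open>(X, Y)\<close> and the pair of fitted values, two points of the bounded set
  \<open>A\<close>, and therefore stays in a ball. No such confinement is assumed for the limiting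
  models, so rejection probabilities are carried from the fitted law to the limiting law by an
  inequality in one direction; an upper bound asks for no more. The exponent \<gamma> / 2 appears
  because (S1) bounds a squared error by the order \<open>m powr (- \<gamma>)\<close>, whereas the
  Lipschitz estimate is linear in the error.

  Shifting both noises by functions of Z makes them dependent through the common Z. If only one of
  them is shifted, one entry depends on its own noise alone and the other on Z and the second noise;
  under the null hypothesis these are independent. Either component may be the one left unshifted,
  whence the minimum of two distances.\<close>

lemma card_low_rank_le:
  fixes T :: "nat \<Rightarrow> real" and c :: real
  assumes "c \<ge> 0"
  shows "real (card {j. j < k \<and> real (card {b. b < k \<and> T b \<ge> T j}) \<le> c}) \<le> c"
proof -
  define J where "J = {j. j < k \<and> real (card {b. b < k \<and> T b \<ge> T j}) \<le> c}"
  have "real (card J) \<le> c"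
  proof (cases "J = {}")
    case True
    then show ?thesis using assms by simp
  next
    case False
    have "finite J" by (simp add: J_def)
    \<comment> \<open>A position with the smallest value in \<open>J\<close> is equalled or exceeded
      by every member of \<open>J\<close>, so its count already contains all of \<open>J\<close>.
      Ties only enlarge that count.\<close>
    then obtain j where j: "j \<in> J" "\<forall>i\<in>J. T j \<le> T i"
      using False by (metis arg_min_if_finite(1) arg_min_least)
    have "J \<subseteq> {b. b < k \<and> T b \<ge> T j}"
      using j by (auto simp: J_def)
    then have "card J \<le> card {b. b < k \<and> T b \<ge> T j}"
      by (intro card_mono) auto
    then show ?thesis using j(1) by (auto simp: J_def)
  qed
  then show ?thesis by (simp add: J_def)
qed

lemma sum_bool_eq_card:
  assumes "finite S"
  shows "(\<Sum>x\<in>S. if P x then 1 else 0 :: real) = real (card {x\<in>S. P x})"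
  using assms by (simp add: sum.If_cases Int_def)

text \<open>Swapping the coordinates i and j permutes the families of length k with values in
  \<open>G\<close>, so every position has a low count equally often. Summing over the k positions
  and exchanging the sums leaves, for each single family, the number of positions with a low count,
  which is at most c whatever the ties.\<close>

lemma sum_top_rank_le:
  fixes t :: "'c \<Rightarrow> real"
  assumes c: "c \<ge> 0" and k: "0 < k" "j < k"
  shows "real k * (\<Sum>\<tau>\<in>PiE_dflt {..<k} d (\<lambda>_. G).
            if real (card {b. b < k \<and> t (\<tau> b) \<ge> t (\<tau> j)}) \<le> c then 1 else 0)
         \<le> c * real (card (PiE_dflt {..<k} d (\<lambda>_. G)))"
proof -
  define E where "E = PiE_dflt {..<k} d (\<lambda>_. G)"
  define r where "r \<tau> j = card {b. b < k \<and> t (\<tau> b) \<ge> t (\<tau> j)}" for \<tau> :: "nat \<Rightarrow> 'c" and j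
  have sym: "(\<Sum>\<tau>\<in>E. if real (r \<tau> i) \<le> c then 1 else 0) = (\<Sum>\<tau>\<in>E. if real (r \<tau> j) \<le> c then 1 else 0 :: real)"
    if i: "i < k" for i
  proof (rule sum.reindex_bij_witness[where i = "\<lambda>\<tau>. \<tau> \<circ> Transposition.transpose i j"
        and j = "\<lambda>\<tau>. \<tau> \<circ> Transposition.transpose i j"])
    fix \<tau> assume "\<tau> \<in> E"
    let ?s = "Transposition.transpose i j"
    have s: "?s b < k \<longleftrightarrow> b < k" for b
      using i k(2) by (auto simp: Transposition.transpose_def)
    have "\<tau> \<circ> ?s \<in> E" if "\<tau> \<in> E" for \<tau>
      using that i k(2) s unfolding E_def PiE_dflt_def by auto
    then show "\<tau> \<circ> ?s \<in> E" "\<tau> \<circ> ?s \<in> E" using \<open>\<tau> \<in> E\<close> by auto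
    have "card {b. b < k \<and> t (\<tau> (?s b)) \<ge> t (\<tau> i)} = card {b. b < k \<and> t (\<tau> b) \<ge> t (\<tau> i)}"
      by (rule bij_betw_same_card[of ?s], rule bij_betw_byWitness[where f' = ?s]) (auto simp: s)
    then show "(if real (r (\<tau> \<circ> ?s) j) \<le> c then 1 else 0) = (if real (r \<tau> i) \<le> c then 1 else 0 :: real)"
      by (simp add: r_def)
  qed auto
  have "real k * (\<Sum>\<tau>\<in>E. if real (r \<tau> j) \<le> c then 1 else 0) =
        (\<Sum>i<k. \<Sum>\<tau>\<in>E. if real (r \<tau> i) \<le> c then 1 else 0)"
    using sym by simp
  also have "\<dots> = (\<Sum>\<tau>\<in>E. \<Sum>i<k. if real (r \<tau> i) \<le> c then 1 else 0)"
    by (rule sum.swap)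
  also have "\<dots> \<le> (\<Sum>\<tau>\<in>E. c)"
  proof (rule sum_mono)
    fix \<tau>
    have "(\<Sum>i<k. if real (r \<tau> i) \<le> c then 1 else 0 :: real) = real (card {i. i < k \<and> real (r \<tau> i) \<le> c})"
      by (simp add: sum_bool_eq_card)
    also have "\<dots> \<le> c" unfolding r_def by (rule card_low_rank_le[OF c])
    finally show "(\<Sum>i<k. if real (r \<tau> i) \<le> c then 1 else 0) \<le> c" .
  qed
  finally show ?thesis by (simp add: E_def r_def mult.commute)
qed

text \<open>If \<open>\<sigma>\<close> and the \<open>\<pi>\<^sub>b\<close> are independent and uniform, then so are \<open>\<sigma>\<close> and the \<open>\<sigma> \<circ> \<pi>\<^sub>b\<close>, whence every
  rank of \<open>t \<sigma>\<close> is equally likely.\<close>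

lemma sum_perm_test_le:
  fixes t :: "('d \<Rightarrow> 'd) \<Rightarrow> real"
  assumes S: "finite S" and \<alpha>: "\<alpha> \<ge> 0"
  defines "G \<equiv> {\<pi>. \<pi> permutes S}"
  shows "(\<Sum>\<sigma>\<in>G. \<Sum>\<pi>s\<in>PiE_dflt {..<B} id (\<lambda>_. G).
            if (1 + real (card {b \<in> {..<B}. t (\<sigma> \<circ> \<pi>s b) \<ge> t \<sigma>})) / (1 + real B) \<le> \<alpha> then 1 else 0)
         \<le> \<alpha> * (real (card G) * real (card (PiE_dflt {..<B} id (\<lambda>_. G))))"
proof -
  define E where "E k = PiE_dflt {..<k::nat} id (\<lambda>_. G)" for k
  define c where "c = \<alpha> * (1 + real B)"
  define q where "q \<sigma> \<pi>s = (if 1 + real (card {b \<in> {..<B}. t (\<pi>s b) \<ge> t \<sigma>}) \<le> c then 1 else 0 :: real)"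
    for \<sigma> and \<pi>s :: "nat \<Rightarrow> 'd \<Rightarrow> 'd"
  have finG: "finite G" unfolding G_def using S by (rule finite_permutations)
  have comp: "\<sigma> \<circ> \<tau> \<in> G" "inv \<sigma> \<in> G" "\<sigma> \<circ> inv \<sigma> = id" "inv \<sigma> \<circ> \<sigma> = id" if "\<sigma> \<in> G" "\<tau> \<in> G" for \<sigma> \<tau>
    using that by (auto simp: G_def permutes_compose permutes_inv permutes_inv_o)
  \<comment> \<open>Left translation by \<sigma> is a bijection of \<open>G\<close>, so composing
    each member of the family with \<sigma> permutes \<open>E B\<close> and frees the permuted
    statistics from \<sigma>. Beyond B the value is set to \<open>id\<close>, the default of
    \<open>PiE_dflt\<close>; composing there as well would in general leave
    \<open>E B\<close>.\<close>
  have shift: "(\<Sum>\<pi>s\<in>E B. if (1 + real (card {b \<in> {..<B}. t (\<sigma> \<circ> \<pi>s b) \<ge> t \<sigma>})) / (1 + real B) \<le> \<alpha> then 1 else 0)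
      = (\<Sum>\<pi>s\<in>E B. q \<sigma> \<pi>s)" if \<sigma>: "\<sigma> \<in> G" for \<sigma>
  proof (rule sum.reindex_bij_witness[where j = "\<lambda>\<pi>s b. if b < B then \<sigma> \<circ> \<pi>s b else id"
        and i = "\<lambda>\<pi>s b. if b < B then inv \<sigma> \<circ> \<pi>s b else id"])
    fix \<pi>s assume \<pi>s: "\<pi>s \<in> E B"
    have "\<sigma> (inv \<sigma> x) = x" "inv \<sigma> (\<sigma> x) = x" for x
      using permutes_inverses[of \<sigma> S] \<sigma> by (auto simp: G_def)
    then show "(\<lambda>b. if b < B then inv \<sigma> \<circ> (if b < B then \<sigma> \<circ> \<pi>s b else id) else id) = \<pi>s"
      and "(\<lambda>b. if b < B then \<sigma> \<circ> (if b < B then inv \<sigma> \<circ> \<pi>s b else id) else id) = \<pi>s"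
      using \<pi>s by (auto simp: E_def PiE_dflt_def fun_eq_iff)
    show "(\<lambda>b. if b < B then \<sigma> \<circ> \<pi>s b else id) \<in> E B" "(\<lambda>b. if b < B then inv \<sigma> \<circ> \<pi>s b else id) \<in> E B"
      using \<pi>s comp(1)[OF \<sigma>] comp(1)[OF comp(2)[OF \<sigma> \<sigma>]] by (auto simp: E_def PiE_dflt_def)
    have "{b \<in> {..<B}. t (if b < B then \<sigma> \<circ> \<pi>s b else id) \<ge> t \<sigma>} = {b \<in> {..<B}. t (\<sigma> \<circ> \<pi>s b) \<ge> t \<sigma>}"
      by auto
    then show "q \<sigma> (\<lambda>b. if b < B then \<sigma> \<circ> \<pi>s b else id) =
       (if (1 + real (card {b \<in> {..<B}. t (\<sigma> \<circ> \<pi>s b) \<ge> t \<sigma>})) / (1 + real B) \<le> \<alpha> then 1 else 0)"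
      by (simp add: q_def c_def field_simps)
  qed
  \<comment> \<open>The observed \<sigma> becomes position B of a family of length B + 1. Its
    comparison with itself supplies the \<open>1 +\<close> of the p-value, so rejection says that
    position B has a count of at most \<open>c = \<alpha> * (1 + real B)\<close>.\<close>
  define q' where "q' \<tau> = (if real (card {b. b < Suc B \<and> t (\<tau> b) \<ge> t (\<tau> B)}) \<le> c then 1 else 0 :: real)"
    for \<tau> :: "nat \<Rightarrow> 'd \<Rightarrow> 'd"
  have "(\<Sum>\<sigma>\<in>G. \<Sum>\<pi>s\<in>E B. q \<sigma> \<pi>s) = (\<Sum>(\<sigma>,\<pi>s)\<in>G \<times> E B. q \<sigma> \<pi>s)"
    by (rule sum.cartesian_product)
  also have "\<dots> = (\<Sum>\<tau>\<in>E (Suc B). q' \<tau>)"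
  proof (rule sum.reindex_bij_witness[where j = "\<lambda>(\<sigma>,\<pi>s). \<pi>s(B := \<sigma>)" and i = "\<lambda>\<tau>. (\<tau> B, \<tau>(B := id))"])
    fix a assume "a \<in> G \<times> E B"
    then obtain \<sigma> \<pi>s where a: "a = (\<sigma>, \<pi>s)" "\<sigma> \<in> G" "\<pi>s \<in> E B" by auto
    have "{b. b < Suc B \<and> t ((\<pi>s(B := \<sigma>)) b) \<ge> t \<sigma>} = insert B {b \<in> {..<B}. t (\<pi>s b) \<ge> t \<sigma>}"
      by auto
    then have "card {b. b < Suc B \<and> t ((\<pi>s(B := \<sigma>)) b) \<ge> t \<sigma>} = Suc (card {b \<in> {..<B}. t (\<pi>s b) \<ge> t \<sigma>})"
      by simp
    then show "q' (case a of (\<sigma>, \<pi>s) \<Rightarrow> \<pi>s(B := \<sigma>)) = (case a of (\<sigma>, \<pi>s) \<Rightarrow> q \<sigma> \<pi>s)"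
      unfolding a(1) q'_def q_def by (simp del: fun_upd_apply add: fun_upd_same)
  qed (auto simp: E_def PiE_dflt_def fun_eq_iff split: if_splits)
  finally have eq: "(\<Sum>\<sigma>\<in>G. \<Sum>\<pi>s\<in>E B. q \<sigma> \<pi>s) = (\<Sum>\<tau>\<in>E (Suc B). q' \<tau>)" .
  have "real (Suc B) * (\<Sum>\<tau>\<in>E (Suc B). q' \<tau>) \<le> c * real (card (E (Suc B)))"
    unfolding q'_def E_def using \<alpha> by (intro sum_top_rank_le) (auto simp: c_def)
  also have "card (E (Suc B)) = card G * card (E B)"
    unfolding E_def using finG by (simp add: card_PiE_dflt)
  finally have "real (Suc B) * (\<Sum>\<tau>\<in>E (Suc B). q' \<tau>) \<le> real (Suc B) * (\<alpha> * (real (card G) * real (card (E B))))"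
    by (simp add: c_def algebra_simps)
  then have "(\<Sum>\<tau>\<in>E (Suc B). q' \<tau>) \<le> \<alpha> * (real (card G) * real (card (E B)))"
    by (simp only: mult_le_cancel_left_pos of_nat_0_less_iff zero_less_Suc)
  then show ?thesis using eq shift by (simp add: E_def)
qed

section \<open>The finite set of families drawn by the permutation test\<close>

definition perm_set :: "nat \<Rightarrow> (nat \<Rightarrow> nat) set" where
  "perm_set n = {\<pi>. \<pi> permutes {..<n}}"

text \<open>The support of \<open>perm_law n B\<close>, with the same default \<open>id\<close>
  beyond B; the law is uniform on it, so that the randomisation turns into a finite average.\<close>

definition perm_families :: "nat \<Rightarrow> nat \<Rightarrow> (nat \<Rightarrow> nat \<Rightarrow> nat) set" where
  "perm_families n B = PiE_dflt {..<B} id (\<lambda>_. perm_set n)"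

lemma finite_perm_set: "finite (perm_set n)" and id_in_perm_set: "id \<in> perm_set n"
  by (auto simp: perm_set_def finite_permutations permutes_id)

lemma finite_perm_families: "finite (perm_families n B)"
  unfolding perm_families_def using finite_perm_set by auto

lemma perm_families_nonempty: "perm_families n B \<noteq> {}"
  unfolding perm_families_def using id_in_perm_set by auto

lemma expectation_perm_law:
  "measure_pmf.expectation (perm_law n B) f = (\<Sum>\<pi>s\<in>perm_families n B. f \<pi>s) / real (card (perm_families n B))"
proof -
  have "perm_law n B = pmf_of_set (perm_families n B)"
    unfolding perm_law_def perm_families_def perm_set_def[symmetric]
    by (rule Pi_pmf_of_set) (use finite_perm_set id_in_perm_set in auto)
  then show ?thesis
    using finite_perm_families perm_families_nonempty by (simp add: integral_pmf_of_set)
qed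

subsection \<open>The randomised test function\<close>

text \<open>Averaging out the permutations leaves a function of the residual matrix alone, with
  values in [0,1]. All later comparisons of laws are made for this function.\<close>

definition resit_cond_reject ::
  "nat \<Rightarrow> nat \<Rightarrow> ((nat \<Rightarrow> 'x \<times> 'y) \<Rightarrow> real) \<Rightarrow> real \<Rightarrow> (nat \<Rightarrow> 'x \<times> 'y) \<Rightarrow> real" where
  "resit_cond_reject n B \<Psi> \<alpha> R = measure_pmf.expectation (perm_law n B) (resit_test n B \<Psi> \<alpha> R)"

lemma resit_cond_reject_eq:
  "resit_cond_reject n B \<Psi> \<alpha> R =
     (\<Sum>\<pi>s\<in>perm_families n B. resit_test n B \<Psi> \<alpha> R \<pi>s) / real (card (perm_families n B))"
  by (simp add: resit_cond_reject_def expectation_perm_law)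

lemma card_perm_families_pos: "0 < card (perm_families n B)"
  using finite_perm_families perm_families_nonempty by (simp add: card_gt_0_iff)

lemma resit_cond_reject_bounds:
  "0 \<le> resit_cond_reject n B \<Psi> \<alpha> R" "resit_cond_reject n B \<Psi> \<alpha> R \<le> 1"
proof -
  show "0 \<le> resit_cond_reject n B \<Psi> \<alpha> R"
    by (auto simp: resit_cond_reject_eq resit_test_def intro!: divide_nonneg_nonneg sum_nonneg)
  have "(\<Sum>\<pi>s\<in>perm_families n B. resit_test n B \<Psi> \<alpha> R \<pi>s) \<le> (\<Sum>\<pi>s\<in>perm_families n B. 1)"
    by (intro sum_mono) (simp add: resit_test_def)
  then show "resit_cond_reject n B \<Psi> \<alpha> R \<le> 1"
    using card_perm_families_pos[of n B] by (simp add: resit_cond_reject_eq divide_le_eq_1)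
qed

lemma perm_familiesD: "\<pi>s \<in> perm_families n B \<Longrightarrow> b < B \<Longrightarrow> \<pi>s b permutes {..<n}"
  by (auto simp: perm_families_def PiE_dflt_def perm_set_def)

lemma borel_measurable_fst_snd [measurable]:
  "fst \<in> borel_measurable (borel :: ('x::second_countable_topology \<times> 'y::second_countable_topology) measure)"
  "snd \<in> borel_measurable (borel :: ('x::second_countable_topology \<times> 'y::second_countable_topology) measure)"
  by (simp_all flip: borel_prod)

lemma measurable_perm_rows:
  assumes "\<pi> permutes {..<n}"
  shows "(\<lambda>R. perm_rows n R \<pi>) \<in> PiM {..<n} (\<lambda>_. borel) \<rightarrow>\<^sub>M
    PiM {..<n} (\<lambda>_. borel :: ('x::second_countable_topology \<times> 'y::second_countable_topology) measure)"
  unfolding perm_rows_def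
proof (rule measurable_restrict)
  fix i assume i: "i \<in> {..<n}"
  then have "\<pi> i \<in> {..<n}" using assms permutes_in_image by fastforce
  with i have [measurable]:
    "(\<lambda>R. R i) \<in> PiM {..<n} (\<lambda>_. borel :: ('x \<times> 'y) measure) \<rightarrow>\<^sub>M borel"
    "(\<lambda>R. R (\<pi> i)) \<in> PiM {..<n} (\<lambda>_. borel :: ('x \<times> 'y) measure) \<rightarrow>\<^sub>M borel"
    by (auto intro!: measurable_component_singleton)
  show "(\<lambda>R. (fst (R i), snd (R (\<pi> i)))) \<in> PiM {..<n} (\<lambda>_. borel) \<rightarrow>\<^sub>M (borel :: ('x \<times> 'y) measure)"
    by (intro borel_measurable_Pair measurable_compose[OF _ borel_measurable_fst_snd(1)]
      measurable_compose[OF _ borel_measurable_fst_snd(2)]) fact+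
qed

context
  fixes \<Psi> :: "(nat \<Rightarrow> 'x::euclidean_space \<times> 'y::euclidean_space) \<Rightarrow> real" and n :: nat
  assumes \<Psi> [measurable]: "\<Psi> \<in> borel_measurable (PiM {..<n} (\<lambda>_. borel))"
begin

lemma measurable_resit_test:
  assumes "\<pi>s \<in> perm_families n B"
  shows "(\<lambda>R. resit_test n B \<Psi> \<alpha> R \<pi>s) \<in> borel_measurable (PiM {..<n} (\<lambda>_. borel))"
proof -
  have [measurable]: "(\<lambda>R. perm_rows n R (\<pi>s b)) \<in> PiM {..<n} (\<lambda>_. borel) \<rightarrow>\<^sub>M
    PiM {..<n} (\<lambda>_. borel :: ('x \<times> 'y) measure)" if "b < B" for b
    using perm_familiesD[OF assms that] by (rule measurable_perm_rows)
  have eq: "resit_pvalue n B \<Psi> R \<pi>s =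
    (1 + (\<Sum>b<B. if \<Psi> (perm_rows n R (\<pi>s b)) \<ge> \<Psi> R then 1 else 0)) / (1 + real B)" for R
    unfolding resit_pvalue_def by (subst sum_bool_eq_card) auto
  have "(\<lambda>R. if \<Psi> (perm_rows n R (\<pi>s b)) \<ge> \<Psi> R then 1 else 0 :: real)
      \<in> borel_measurable (PiM {..<n} (\<lambda>_. borel))" if "b \<in> {..<B}" for b
  proof -
    have [measurable]: "(\<lambda>R. \<Psi> (perm_rows n R (\<pi>s b))) \<in> borel_measurable (PiM {..<n} (\<lambda>_. borel))"
      using that by (intro measurable_compose[OF _ \<Psi>]) auto
    show ?thesis by measurable
  qed
  then have [measurable]: "(\<lambda>R. resit_pvalue n B \<Psi> R \<pi>s) \<in> borel_measurable (PiM {..<n} (\<lambda>_. borel))"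
    unfolding eq by (intro borel_measurable_divide borel_measurable_add borel_measurable_sum) auto
  show ?thesis unfolding resit_test_def by measurable
qed

lemma measurable_resit_cond_reject [measurable]:
  "resit_cond_reject n B \<Psi> \<alpha> \<in> borel_measurable (PiM {..<n} (\<lambda>_. borel))"
  unfolding resit_cond_reject_eq[abs_def]
  by (intro borel_measurable_divide borel_measurable_sum measurable_resit_test) auto

end

section \<open>Comparison of rejection probabilities in total variation\<close>

lemma measure_le_tv_dist:
  assumes "prob_space M" "prob_space N" "S \<in> sets M"
  shows "measure M S \<le> measure N S + tv_dist M N"
proof -
  interpret M: prob_space M by fact
  interpret N: prob_space N by fact
  \<comment> \<open>The supremum in \<open>tv_dist\<close> is one of real numbers and dominates its
    members only if they are bounded above; for probability measures 1 is a bound.\<close>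
  have "bdd_above ((\<lambda>A. \<bar>measure M A - measure N A\<bar>) ` sets M)"
  proof (rule bdd_aboveI2)
    fix A show "\<bar>measure M A - measure N A\<bar> \<le> 1"
      using M.prob_le_1[of A] N.prob_le_1[of A] measure_nonneg[of M A] measure_nonneg[of N A] by linarith
  qed
  then have "\<bar>measure M S - measure N S\<bar> \<le> tv_dist M N"
    unfolding tv_dist_def using assms(3) by (intro cSUP_upper)
  then show ?thesis by linarith
qed

lemma prob_space_integrable_bounded:
  fixes f :: "'a \<Rightarrow> real"
  assumes "prob_space M" "f \<in> borel_measurable M" "\<And>x. 0 \<le> f x" "\<And>x. f x \<le> 1"
  shows "integrable M f"
proof -
  interpret prob_space M by fact
  show ?thesis by (rule integrable_const_bound[where B = 1]) (use assms in auto)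
qed

text \<open>For a fixed family of permutations the test is the indicator of an event, and the
  probabilities of an event differ by at most \<open>tv_dist\<close>. Averaging over the families
  keeps the constant 1.\<close>

lemma integral_resit_cond_reject_le_tv:
  fixes \<Psi> :: "(nat \<Rightarrow> 'x::euclidean_space \<times> 'y::euclidean_space) \<Rightarrow> real"
  assumes \<Psi>: "\<Psi> \<in> borel_measurable (PiM {..<n} (\<lambda>_. borel))"
    and M: "prob_space M" "sets M = sets (PiM {..<n} (\<lambda>_. borel))"
    and N: "prob_space N" "sets N = sets (PiM {..<n} (\<lambda>_. borel))"
  shows "(\<integral>R. resit_cond_reject n B \<Psi> \<alpha> R \<partial>M) \<le> (\<integral>R. resit_cond_reject n B \<Psi> \<alpha> R \<partial>N) + tv_dist M N"
proof -
  let ?F = "perm_families n B" and ?S = "\<lambda>\<pi>s. {R \<in> space M. resit_test n B \<Psi> \<alpha> R \<pi>s = 1}"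
  have meas: "(\<lambda>R. resit_test n B \<Psi> \<alpha> R \<pi>s) \<in> borel_measurable K"
    if "\<pi>s \<in> ?F" "sets K = sets (PiM {..<n} (\<lambda>_. borel :: ('x \<times> 'y) measure))" for \<pi>s K
    using measurable_resit_test[OF \<Psi> that(1)] that(2) by (simp cong: measurable_cong_sets)
  have sp: "space N = space M" using M N by (metis sets_eq_imp_space_eq)
  have int: "(\<integral>R. resit_test n B \<Psi> \<alpha> R \<pi>s \<partial>K) = measure K (?S \<pi>s)"
    if "\<pi>s \<in> ?F" "sets K = sets (PiM {..<n} (\<lambda>_. borel :: ('x \<times> 'y) measure))" "space K = space M" for \<pi>s K
  proof -
    have [measurable]: "(\<lambda>R. resit_test n B \<Psi> \<alpha> R \<pi>s) \<in> borel_measurable K" by (rule meas[OF that(1,2)])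
    have "(\<integral>R. resit_test n B \<Psi> \<alpha> R \<pi>s \<partial>K) = (\<integral>R. indicator (?S \<pi>s) R \<partial>K)"
      using that(3) by (intro Bochner_Integration.integral_cong) (auto simp: resit_test_def indicator_def)
    also have "\<dots> = measure K (?S \<pi>s \<inter> space K)"
      by simp
    also have "?S \<pi>s \<inter> space K = ?S \<pi>s"
      using that(3) by auto
    finally show ?thesis .
  qed
  have avg: "(\<integral>R. resit_cond_reject n B \<Psi> \<alpha> R \<partial>K) = (\<Sum>\<pi>s\<in>?F. measure K (?S \<pi>s)) / real (card ?F)"
    if "prob_space K" "sets K = sets (PiM {..<n} (\<lambda>_. borel :: ('x \<times> 'y) measure))" "space K = space M" for K
  proof -
    have "integrable K (\<lambda>R. resit_test n B \<Psi> \<alpha> R \<pi>s)" if "\<pi>s \<in> ?F" for \<pi>s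
      using meas[OF that \<open>sets K = _\<close>]
      by (intro prob_space_integrable_bounded[OF \<open>prob_space K\<close>]) (auto simp: resit_test_def)
    then show ?thesis
      unfolding resit_cond_reject_eq using int that
      by (simp add: Bochner_Integration.integral_sum)
  qed
  have "(\<Sum>\<pi>s\<in>?F. measure M (?S \<pi>s)) \<le> (\<Sum>\<pi>s\<in>?F. measure N (?S \<pi>s) + tv_dist M N)"
    using meas[OF _ M(2)] by (intro sum_mono measure_le_tv_dist M N) measurable
  also have "\<dots> = (\<Sum>\<pi>s\<in>?F. measure N (?S \<pi>s)) + real (card ?F) * tv_dist M N"
    by (simp add: sum.distrib)
  finally show ?thesis
    unfolding avg[OF M refl] avg[OF N sp] using card_perm_families_pos[of n B]
    by (simp add: field_simps)
qed

text \<open>Reads a matrix with n independent rows as two independent columns, so that one column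
  can be permuted while the other is held fixed. In the induction on the number of rows, Fubini
  separates the two entries of the last row, and a second exchange moves its x entry next to the
  first column.\<close>

lemma nn_integral_PiM_pair:
  fixes M1 :: "'a measure" and M2 :: "'b measure"
  assumes M1: "prob_space M1" and M2: "prob_space M2"
    and f: "f \<in> borel_measurable (PiM {..<n::nat} (\<lambda>_. M1 \<Otimes>\<^sub>M M2))"
  shows "(\<integral>\<^sup>+D. f D \<partial>PiM {..<n} (\<lambda>_. M1 \<Otimes>\<^sub>M M2)) =
    (\<integral>\<^sup>+x. \<integral>\<^sup>+y. f (\<lambda>i\<in>{..<n}. (x i, y i)) \<partial>PiM {..<n} (\<lambda>_. M2) \<partial>PiM {..<n} (\<lambda>_. M1))"
  using f
proof (induction n arbitrary: f)
  case 0
  then show ?case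
    by (simp add: PiM_empty nn_integral_count_space_finite)
next
  case (Suc n)
  interpret M1: prob_space M1 by fact
  interpret M2: prob_space M2 by fact
  interpret P: pair_prob_space M1 M2 ..
  interpret S1: product_sigma_finite "\<lambda>_::nat. M1" by standard
  interpret S2: product_sigma_finite "\<lambda>_::nat. M2" by standard
  interpret S: product_sigma_finite "\<lambda>_::nat. M1 \<Otimes>\<^sub>M M2" by standard
  have ins: "{..<Suc n} = insert n {..<n}" by auto
  have ni: "n \<notin> {..<n}" by simp
  note [measurable] = Suc.prems[unfolded ins]
  interpret Q2: prob_space "PiM {..<n} (\<lambda>_. M2)" by (intro prob_space_PiM M2)
  interpret F: pair_sigma_finite "PiM {..<n} (\<lambda>_. M2)" M1 ..
  let ?z = "\<lambda>x y. \<lambda>i\<in>{..<n}. (x i, y i)"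
  have zip: "(\<lambda>i\<in>{..<Suc n}. ((x(n := a)) i, (y(n := b)) i)) = (?z x y)(n := (a, b))" for x :: "nat \<Rightarrow> 'a" and y :: "nat \<Rightarrow> 'b" and a b
    by (auto simp: fun_eq_iff restrict_def)
  have zipm [measurable]: "(\<lambda>(x, y). ?z x y) \<in>
     PiM {..<n} (\<lambda>_. M1) \<Otimes>\<^sub>M PiM {..<n} (\<lambda>_. M2) \<rightarrow>\<^sub>M PiM {..<n} (\<lambda>_. M1 \<Otimes>\<^sub>M M2)"
    by measurable
  have zipm' [measurable]: "(\<lambda>(x, y). \<lambda>i\<in>insert n {..<n}. (x i, y i)) \<in>
     PiM (insert n {..<n}) (\<lambda>_. M1) \<Otimes>\<^sub>M PiM (insert n {..<n}) (\<lambda>_. M2) \<rightarrow>\<^sub>M PiM (insert n {..<n}) (\<lambda>_. M1 \<Otimes>\<^sub>M M2)"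
    by measurable
  have "(\<integral>\<^sup>+D. f D \<partial>PiM {..<Suc n} (\<lambda>_. M1 \<Otimes>\<^sub>M M2)) =
    (\<integral>\<^sup>+D. \<integral>\<^sup>+v. f (D(n := v)) \<partial>(M1 \<Otimes>\<^sub>M M2) \<partial>PiM {..<n} (\<lambda>_. M1 \<Otimes>\<^sub>M M2))"
    unfolding ins by (rule S.product_nn_integral_insert) auto
  also have "\<dots> = (\<integral>\<^sup>+x. \<integral>\<^sup>+y. \<integral>\<^sup>+v. f ((?z x y)(n := v)) \<partial>(M1 \<Otimes>\<^sub>M M2)
      \<partial>PiM {..<n} (\<lambda>_. M2) \<partial>PiM {..<n} (\<lambda>_. M1))"
    by (rule Suc.IH) measurable
  also have "\<dots> = (\<integral>\<^sup>+x. \<integral>\<^sup>+y. \<integral>\<^sup>+a. \<integral>\<^sup>+b. f ((?z x y)(n := (a, b))) \<partial>M2 \<partial>M1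
      \<partial>PiM {..<n} (\<lambda>_. M2) \<partial>PiM {..<n} (\<lambda>_. M1))"
    by (intro nn_integral_cong M2.nn_integral_fst[symmetric]) measurable
  also have "\<dots> = (\<integral>\<^sup>+x. \<integral>\<^sup>+a. \<integral>\<^sup>+y. \<integral>\<^sup>+b. f ((?z x y)(n := (a, b))) \<partial>M2
      \<partial>PiM {..<n} (\<lambda>_. M2) \<partial>M1 \<partial>PiM {..<n} (\<lambda>_. M1))"
    by (intro nn_integral_cong F.Fubini'[symmetric]) measurable
  also have "\<dots> = (\<integral>\<^sup>+x. \<integral>\<^sup>+a. \<integral>\<^sup>+y. f (\<lambda>i\<in>{..<Suc n}. ((x(n := a)) i, y i))
      \<partial>PiM {..<Suc n} (\<lambda>_. M2) \<partial>M1 \<partial>PiM {..<n} (\<lambda>_. M1))"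
  proof (intro nn_integral_cong)
    fix x a assume "x \<in> space (PiM {..<n} (\<lambda>_. M1))" "a \<in> space M1"
    then have [measurable]: "x(n := a) \<in> space (PiM (insert n {..<n}) (\<lambda>_. M1))"
      by (auto simp: space_PiM PiE_iff extensional_def)
    have "(\<lambda>y. f (\<lambda>i\<in>insert n {..<n}. ((x(n := a)) i, y i))) \<in> borel_measurable (PiM (insert n {..<n}) (\<lambda>_. M2))"
      using measurable_compose[OF measurable_Pair2[OF zipm' \<open>x(n := a) \<in> _\<close>] Suc.prems[unfolded ins]]
      by (simp only: prod.case)
    from S2.product_nn_integral_insert[OF _ ni this]
    show "(\<integral>\<^sup>+y. \<integral>\<^sup>+b. f ((?z x y)(n := (a, b))) \<partial>M2 \<partial>PiM {..<n} (\<lambda>_. M2)) =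
      (\<integral>\<^sup>+y. f (\<lambda>i\<in>{..<Suc n}. ((x(n := a)) i, y i)) \<partial>PiM {..<Suc n} (\<lambda>_. M2))"
      by (simp add: ins[symmetric] zip del: fun_upd_apply)
  qed
  also have "\<dots> = (\<integral>\<^sup>+x. \<integral>\<^sup>+y. f (\<lambda>i\<in>{..<Suc n}. (x i, y i))
      \<partial>PiM {..<Suc n} (\<lambda>_. M2) \<partial>PiM {..<Suc n} (\<lambda>_. M1))"
  proof -
    interpret Q2': prob_space "PiM (insert n {..<n}) (\<lambda>_. M2)" by (intro prob_space_PiM M2)
    show ?thesis unfolding ins
      by (rule S1.product_nn_integral_insert[symmetric]) auto
  qed
  finally show ?case .
qed

subsection \<open>Validity of the permutation test under independence\<close>

text \<open>The independence of the two components enters here: for a fixed x column,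
  \<open>perm_rows\<close> merely reindexes the y column, whose product law is invariant under
  reindexing by a permutation.\<close>

lemma distr_perm_rows:
  fixes M1 :: "'x::euclidean_space measure" and M2 :: "'y::euclidean_space measure"
  assumes M1: "prob_space M1" "sets M1 = sets borel" and M2: "prob_space M2" "sets M2 = sets borel"
    and \<sigma>: "\<sigma> permutes {..<n}"
  defines "K \<equiv> PiM {..<n} (\<lambda>_. M1 \<Otimes>\<^sub>M M2)"
  shows "distr K K (\<lambda>D. perm_rows n D \<sigma>) = K"
proof -
  have setsR: "sets (M1 \<Otimes>\<^sub>M M2) = sets borel"
    using M1 M2 by (metis borel_prod sets_pair_measure_cong)
  then have setsK: "sets K = sets (PiM {..<n} (\<lambda>_. borel))"
    unfolding K_def by (intro sets_PiM_cong) auto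
  have pm [measurable]: "(\<lambda>D. perm_rows n D \<sigma>) \<in> K \<rightarrow>\<^sub>M K"
    using measurable_perm_rows[OF \<sigma>, where ?'x = 'x and ?'y = 'y] setsK by (simp cong: measurable_cong_sets)
  have \<sigma>i: "\<sigma> i < n \<longleftrightarrow> i < n" for i
    using permutes_in_image[OF \<sigma>, of i] by simp
  let ?Y = "PiM {..<n} (\<lambda>_. M2)"
  have "(\<lambda>y. \<lambda>i\<in>{..<n}. y (\<sigma> i)) \<in> ?Y \<rightarrow>\<^sub>M ?Y"
    using \<sigma>i by (intro measurable_restrict measurable_component_singleton) auto
  note ym [measurable] = this
  have reindex: "distr ?Y ?Y (\<lambda>y. \<lambda>i\<in>{..<n}. y (\<sigma> i)) = ?Y"
    using \<sigma> \<sigma>i M2 by (intro distr_PiM_reindex) (auto simp: permutes_inj_on)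
  show ?thesis
  proof (rule measure_eqI)
    fix S assume "S \<in> sets (distr K K (\<lambda>D. perm_rows n D \<sigma>))"
    then have S [measurable]: "S \<in> sets K" by simp
    have Sm: "(\<lambda>D. indicator S D :: ennreal) \<in> borel_measurable (PiM {..<n} (\<lambda>_. M1 \<Otimes>\<^sub>M M2))"
      using S unfolding K_def[symmetric] by measurable
    have Spm: "(\<lambda>D. indicator S (perm_rows n D \<sigma>) :: ennreal) \<in> borel_measurable (PiM {..<n} (\<lambda>_. M1 \<Otimes>\<^sub>M M2))"
      using S unfolding K_def[symmetric] by measurable
    have "emeasure (distr K K (\<lambda>D. perm_rows n D \<sigma>)) S = (\<integral>\<^sup>+D. indicator S (perm_rows n D \<sigma>) \<partial>K)"
      using nn_integral_distr[OF pm, of "indicator S"] by simp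
    also have "\<dots> = (\<integral>\<^sup>+x. \<integral>\<^sup>+y. indicator S (perm_rows n (\<lambda>i\<in>{..<n}. (x i, y i)) \<sigma>)
        \<partial>?Y \<partial>PiM {..<n} (\<lambda>_. M1))"
      unfolding K_def by (rule nn_integral_PiM_pair[OF M1(1) M2(1) Spm])
    also have "\<dots> = (\<integral>\<^sup>+x. \<integral>\<^sup>+y. indicator S (\<lambda>i\<in>{..<n}. (x i, y i)) \<partial>?Y \<partial>PiM {..<n} (\<lambda>_. M1))"
    proof (rule nn_integral_cong)
      fix x assume x: "x \<in> space (PiM {..<n} (\<lambda>_. M1))"
      have zip: "(\<lambda>(x, y). \<lambda>i\<in>{..<n}. (x i, y i)) \<in> PiM {..<n} (\<lambda>_. M1) \<Otimes>\<^sub>M ?Y \<rightarrow>\<^sub>M PiM {..<n} (\<lambda>_. M1 \<Otimes>\<^sub>M M2)"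
        by measurable
      have zm: "(\<lambda>y. indicator S (\<lambda>i\<in>{..<n}. (x i, y i)) :: ennreal) \<in> borel_measurable ?Y"
        using measurable_compose[OF measurable_Pair2[OF zip x] Sm] by (simp only: prod.case)
      have "(\<integral>\<^sup>+y. indicator S (\<lambda>i\<in>{..<n}. (x i, y i)) \<partial>?Y) =
          (\<integral>\<^sup>+y. indicator S (\<lambda>i\<in>{..<n}. (x i, y i)) \<partial>distr ?Y ?Y (\<lambda>y. \<lambda>i\<in>{..<n}. y (\<sigma> i)))"
        by (simp only: reindex)
      also have "\<dots> = (\<integral>\<^sup>+y. indicator S (\<lambda>i\<in>{..<n}. (x i, (\<lambda>i\<in>{..<n}. y (\<sigma> i)) i)) \<partial>?Y)"
        by (rule nn_integral_distr[OF ym]) (use zm in simp)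
      also have "\<dots> = (\<integral>\<^sup>+y. indicator S (perm_rows n (\<lambda>i\<in>{..<n}. (x i, y i)) \<sigma>) \<partial>?Y)"
        by (intro nn_integral_cong arg_cong[of _ _ "indicator S"]) (auto simp: perm_rows_def restrict_def \<sigma>i)
      finally show "(\<integral>\<^sup>+y. indicator S (perm_rows n (\<lambda>i\<in>{..<n}. (x i, y i)) \<sigma>) \<partial>?Y) =
          (\<integral>\<^sup>+y. indicator S (\<lambda>i\<in>{..<n}. (x i, y i)) \<partial>?Y)" ..
    qed
    also have "\<dots> = (\<integral>\<^sup>+D. indicator S D \<partial>K)"
      unfolding K_def by (rule nn_integral_PiM_pair[OF M1(1) M2(1) Sm, symmetric])
    finally show "emeasure (distr K K (\<lambda>D. perm_rows n D \<sigma>)) S = emeasure K S" by simp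
  qed simp
qed

text \<open>Permutations compose on the right: permuting data that \<sigma> has already permuted
  leads to \<sigma> \<circ> \<pi>, the form treated in \<open>sum_perm_test_le\<close>.\<close>

lemma perm_rows_perm_rows:
  "\<pi> permutes {..<n} \<Longrightarrow> perm_rows n (perm_rows n D \<sigma>) \<pi> = perm_rows n D (\<sigma> \<circ> \<pi>)"
  using permutes_in_image[of \<pi> "{..<n}"] by (fastforce simp: perm_rows_def restrict_def)

text \<open>Under a product law no \<sigma> changes the integral, so the integrand may be replaced
  by its mean over all \<sigma>. That mean is at most \<alpha> for every single matrix D, by
  \<open>sum_perm_test_le\<close> applied to the statistic along the orbit of D; this last step is
  purely combinatorial.\<close>

lemma integral_resit_cond_reject_le_alpha:
  fixes \<Psi> :: "(nat \<Rightarrow> 'x::euclidean_space \<times> 'y::euclidean_space) \<Rightarrow> real"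
    and M1 :: "'x measure" and M2 :: "'y measure"
  assumes \<Psi>: "\<Psi> \<in> borel_measurable (PiM {..<n} (\<lambda>_. borel))"
    and M1: "prob_space M1" "sets M1 = sets borel" and M2: "prob_space M2" "sets M2 = sets borel"
    and \<alpha>: "\<alpha> \<ge> 0"
  shows "(\<integral>D. resit_cond_reject n B \<Psi> \<alpha> D \<partial>PiM {..<n} (\<lambda>_. M1 \<Otimes>\<^sub>M M2)) \<le> \<alpha>"
proof -
  define K where "K = PiM {..<n} (\<lambda>_. M1 \<Otimes>\<^sub>M M2)"
  let ?r = "resit_cond_reject n B \<Psi> \<alpha>" and ?G = "perm_set n" and ?F = "perm_families n B"
  have "prob_space (M1 \<Otimes>\<^sub>M M2)" using M1 M2 by (intro prob_space_pair)
  then interpret K: prob_space K unfolding K_def by (intro prob_space_PiM)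
  have setsR: "sets (M1 \<Otimes>\<^sub>M M2) = sets borel"
    using M1 M2 by (metis borel_prod sets_pair_measure_cong)
  then have setsK: "sets K = sets (PiM {..<n} (\<lambda>_. borel))"
    unfolding K_def by (intro sets_PiM_cong) auto
  have rm: "?r \<in> borel_measurable K"
    using measurable_resit_cond_reject[OF \<Psi>] setsK by (simp cong: measurable_cong_sets)
  have pm: "(\<lambda>D. perm_rows n D \<sigma>) \<in> K \<rightarrow>\<^sub>M K" if "\<sigma> \<in> ?G" for \<sigma>
    using measurable_perm_rows[of \<sigma> n, where ?'x = 'x and ?'y = 'y] setsK that
    by (simp add: perm_set_def cong: measurable_cong_sets)
  have inv: "(\<integral>D. ?r (perm_rows n D \<sigma>) \<partial>K) = (\<integral>D. ?r D \<partial>K)" if "\<sigma> \<in> ?G" for \<sigma>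
    using integral_distr[OF pm[OF that] rm] distr_perm_rows[OF M1 M2, of \<sigma> n] that
    by (simp add: K_def perm_set_def)
  have cG: "0 < card ?G" using finite_perm_set id_in_perm_set by (auto simp: card_gt_0_iff)
  have pt: "(\<Sum>\<sigma>\<in>?G. ?r (perm_rows n D \<sigma>)) \<le> \<alpha> * real (card ?G)" for D
  proof -
    let ?t = "\<lambda>\<tau>. \<Psi> (perm_rows n D \<tau>)"
    have "(\<Sum>\<sigma>\<in>?G. ?r (perm_rows n D \<sigma>)) =
      (\<Sum>\<sigma>\<in>?G. \<Sum>\<pi>s\<in>?F. resit_test n B \<Psi> \<alpha> (perm_rows n D \<sigma>) \<pi>s) / real (card ?F)"
      by (simp add: resit_cond_reject_eq sum_divide_distrib)
    also have "(\<Sum>\<sigma>\<in>?G. \<Sum>\<pi>s\<in>?F. resit_test n B \<Psi> \<alpha> (perm_rows n D \<sigma>) \<pi>s) =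
      (\<Sum>\<sigma>\<in>?G. \<Sum>\<pi>s\<in>?F. if (1 + real (card {b \<in> {..<B}. ?t (\<sigma> \<circ> \<pi>s b) \<ge> ?t \<sigma>})) / (1 + real B) \<le> \<alpha> then 1 else 0)"
    proof (intro sum.cong refl)
      fix \<sigma> \<pi>s assume "\<pi>s \<in> ?F"
      then have "{b \<in> {..<B}. \<Psi> (perm_rows n (perm_rows n D \<sigma>) (\<pi>s b)) \<ge> ?t \<sigma>} = {b \<in> {..<B}. ?t (\<sigma> \<circ> \<pi>s b) \<ge> ?t \<sigma>}"
        by (auto simp: perm_familiesD perm_rows_perm_rows)
      then show "resit_test n B \<Psi> \<alpha> (perm_rows n D \<sigma>) \<pi>s =
        (if (1 + real (card {b \<in> {..<B}. ?t (\<sigma> \<circ> \<pi>s b) \<ge> ?t \<sigma>})) / (1 + real B) \<le> \<alpha> then 1 else 0)"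
        by (simp only: resit_test_def resit_pvalue_def)
    qed
    also have "\<dots> \<le> \<alpha> * (real (card ?G) * real (card ?F))"
      unfolding perm_families_def perm_set_def by (intro sum_perm_test_le \<alpha>) auto
    finally show ?thesis
      using card_perm_families_pos[of n B] by (simp add: field_simps)
  qed
  have int: "integrable K (\<lambda>D. ?r (perm_rows n D \<sigma>))" if "\<sigma> \<in> ?G" for \<sigma>
    using measurable_compose[OF pm[OF that] rm]
    by (intro prob_space_integrable_bounded K.prob_space_axioms) (auto simp: resit_cond_reject_bounds)
  have "real (card ?G) * (\<integral>D. ?r D \<partial>K) = (\<Sum>\<sigma>\<in>?G. \<integral>D. ?r (perm_rows n D \<sigma>) \<partial>K)"
    using inv by simp
  also have "\<dots> = (\<integral>D. (\<Sum>\<sigma>\<in>?G. ?r (perm_rows n D \<sigma>)) \<partial>K)"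
    using int by (simp add: Bochner_Integration.integral_sum)
  also have "\<dots> \<le> (\<integral>D. \<alpha> * real (card ?G) \<partial>K)"
    using int pt by (intro integral_mono) auto
  also have "\<dots> = real (card ?G) * \<alpha>" by (simp add: K.prob_space)
  finally show ?thesis using cG by (simp add: K_def)
qed

subsection \<open>Laws of shifted noise\<close>

lemma measurable_shift:
  fixes s1 :: "'z \<Rightarrow> 'x::euclidean_space" and s2 :: "'z \<Rightarrow> 'y::euclidean_space"
  assumes PN: "sets PN = sets borel"
    and s [measurable]: "s1 \<in> borel_measurable PZ" "s2 \<in> borel_measurable PZ"
  shows "(\<lambda>(z, e, h). (e - s1 z, h - s2 z)) \<in> borel_measurable (PZ \<Otimes>\<^sub>M PN)"
proof -
  have "sets (PZ \<Otimes>\<^sub>M PN) = sets (PZ \<Otimes>\<^sub>M (borel \<Otimes>\<^sub>M borel))"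
    unfolding borel_prod using PN by (intro sets_pair_measure_cong refl)
  moreover have "(\<lambda>(z, e, h). (e - s1 z, h - s2 z)) \<in> borel_measurable (PZ \<Otimes>\<^sub>M (borel \<Otimes>\<^sub>M borel))"
    unfolding borel_prod[symmetric] by measurable
  ultimately show ?thesis by (simp cong: measurable_cong_sets)
qed

lemma prob_space_shifted_noise_law:
  assumes "prob_space PZ" "prob_space PN" "sets PN = sets borel"
    and "s1 \<in> borel_measurable PZ" "s2 \<in> borel_measurable PZ"
  shows "prob_space (shifted_noise_law PZ PN s1 s2)"
proof -
  interpret pair_prob_space PZ PN using assms by (simp add: pair_prob_space_def pair_sigma_finite_def prob_space_imp_sigma_finite)
  show ?thesis unfolding shifted_noise_law_def
    by (rule P.prob_space_distr) (rule measurable_shift[OF assms(3-5)])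
qed

lemma sets_shifted_noise_law [simp, measurable_cong]: "sets (shifted_noise_law PZ PN s1 s2) = sets borel"
  by (simp add: shifted_noise_law_def)

text \<open>Subtracting the pair of shifts as one vector prepares the change of variables in
  \<open>nn_integral_density_shift\<close>.\<close>

lemma nn_integral_shifted_noise_law:
  fixes s1 :: "'z \<Rightarrow> 'x::euclidean_space" and s2 :: "'z \<Rightarrow> 'y::euclidean_space"
  assumes PN: "prob_space PN" "sets PN = sets borel"
    and s: "s1 \<in> borel_measurable PZ" "s2 \<in> borel_measurable PZ"
    and f: "f \<in> borel_measurable borel"
  shows "(\<integral>\<^sup>+w. f w \<partial>shifted_noise_law PZ PN s1 s2) = (\<integral>\<^sup>+z. \<integral>\<^sup>+v. f (v - (s1 z, s2 z)) \<partial>PN \<partial>PZ)"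
proof -
  interpret PN: prob_space PN by fact
  note m = measurable_shift[OF PN(2) s]
  have "(\<integral>\<^sup>+w. f w \<partial>shifted_noise_law PZ PN s1 s2) =
    (\<integral>\<^sup>+u. f ((\<lambda>(z, e, h). (e - s1 z, h - s2 z)) u) \<partial>(PZ \<Otimes>\<^sub>M PN))"
    unfolding shifted_noise_law_def by (rule nn_integral_distr[OF m]) (use f in simp)
  also have "\<dots> = (\<integral>\<^sup>+z. \<integral>\<^sup>+v. f ((\<lambda>(z, e, h). (e - s1 z, h - s2 z)) (z, v)) \<partial>PN \<partial>PZ)"
    by (rule PN.nn_integral_fst[symmetric]) (rule measurable_compose[OF m f])
  also have "\<dots> = (\<integral>\<^sup>+z. \<integral>\<^sup>+v. f (v - (s1 z, s2 z)) \<partial>PN \<partial>PZ)"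
    by (intro nn_integral_cong arg_cong[of _ _ f]) (auto split: prod.split)
  finally show ?thesis .
qed

text \<open>Translation invariance of Lebesgue measure moves the shift from f to the density, where
  the Lipschitz condition can act on it.\<close>

lemma nn_integral_density_shift:
  fixes pd :: "'a::euclidean_space \<Rightarrow> real"
  assumes [measurable]: "pd \<in> borel_measurable borel" "f \<in> borel_measurable borel"
  shows "(\<integral>\<^sup>+v. f (v - a) \<partial>density lborel (\<lambda>v. ennreal (pd v))) = (\<integral>\<^sup>+w. ennreal (pd (a + w)) * f w \<partial>lborel)"
proof -
  have "(\<integral>\<^sup>+v. f (v - a) \<partial>density lborel (\<lambda>v. ennreal (pd v))) = (\<integral>\<^sup>+v. ennreal (pd v) * f (v - a) \<partial>lborel)"
    by (rule nn_integral_density) auto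
  also have "\<dots> = (\<integral>\<^sup>+v. ennreal (pd v) * f (v - a) \<partial>distr lborel borel ((+) a))"
    by (simp add: lborel_distr_plus)
  also have "\<dots> = (\<integral>\<^sup>+w. ennreal (pd (a + w)) * f w \<partial>lborel)"
    by (subst nn_integral_distr) auto
  finally show ?thesis .
qed

text \<open>Only the law with shift \<^term>\<open>t\<close> has to be concentrated on a ball: the comparison is
  one-sided, and the mass that the other law puts outside the ball can be dropped.\<close>

lemma nn_integral_shifted_noise_law_le:
  fixes s1 t1 :: "'z \<Rightarrow> 'x::euclidean_space" and s2 t2 :: "'z \<Rightarrow> 'y::euclidean_space"
  assumes PZ: "prob_space PZ" and PN: "prob_space PN"
    and dens: "PN = density lborel (\<lambda>v. ennreal (pd v))"
    and pd [measurable]: "pd \<in> borel_measurable borel" and pd0: "\<And>v. pd v \<ge> 0"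
    and lip: "L-lipschitz_on UNIV pd"
    and s [measurable]: "s1 \<in> borel_measurable PZ" "s2 \<in> borel_measurable PZ"
    and t [measurable]: "t1 \<in> borel_measurable PZ" "t2 \<in> borel_measurable PZ"
    and supp: "AE w in shifted_noise_law PZ PN t1 t2. norm w \<le> r"
    and f [measurable]: "f \<in> borel_measurable borel" and f1: "\<And>w. f w \<le> 1"
  shows "(\<integral>\<^sup>+w. f w \<partial>shifted_noise_law PZ PN t1 t2) \<le> (\<integral>\<^sup>+w. f w \<partial>shifted_noise_law PZ PN s1 s2)
    + ennreal L * emeasure lborel (cball (0 :: 'x \<times> 'y) r)
      * (\<integral>\<^sup>+z. ennreal (norm (t1 z - s1 z)) + ennreal (norm (t2 z - s2 z)) \<partial>PZ)"
proof -
  interpret PZ: prob_space PZ by fact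
  have setsPN: "sets PN = sets borel" using dens by simp
  let ?K = "cball (0 :: 'x \<times> 'y) r"
  let ?d = "\<lambda>z. norm (t1 z - s1 z) + norm (t2 z - s2 z)"
  let ?g = "\<lambda>w. f w * indicator ?K w"
  have L0: "L \<ge> 0" using lip by (rule lipschitz_on_nonneg)
  have [measurable]: "?K \<in> sets borel" by simp
  have g [measurable]: "?g \<in> borel_measurable borel" by measurable
  have "(\<integral>\<^sup>+w. f w \<partial>shifted_noise_law PZ PN t1 t2) = (\<integral>\<^sup>+w. ?g w \<partial>shifted_noise_law PZ PN t1 t2)"
    using supp by (intro nn_integral_cong_AE) (auto simp: dist_norm indicator_def)
  also have "\<dots> = (\<integral>\<^sup>+z. \<integral>\<^sup>+w. ennreal (pd ((t1 z, t2 z) + w)) * ?g w \<partial>lborel \<partial>PZ)"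
    unfolding nn_integral_shifted_noise_law[OF PN setsPN t g]
    by (simp only: dens nn_integral_density_shift[OF pd g])
  \<comment> \<open>Dropping the indicator of the ball in the term with s only increases the
    right-hand side. It is kept in the Lipschitz error, which would otherwise be integrated over
    infinite volume.\<close>
  also have "\<dots> \<le> (\<integral>\<^sup>+z. (\<integral>\<^sup>+w. ennreal (pd ((s1 z, s2 z) + w)) * f w \<partial>lborel) + ennreal L * ennreal (?d z) * emeasure lborel ?K \<partial>PZ)"
  proof (rule nn_integral_mono)
    fix z
    have "ennreal (pd ((t1 z, t2 z) + w)) * ?g w \<le>
      ennreal (pd ((s1 z, s2 z) + w)) * f w + ennreal L * ennreal (?d z) * indicator ?K w" for w
    proof (cases "w \<in> ?K")
      case True
      have "\<bar>pd ((t1 z, t2 z) + w) - pd ((s1 z, s2 z) + w)\<bar> \<le> L * norm ((t1 z, t2 z) - (s1 z, s2 z))"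
        using lipschitz_onD[OF lip, of "(t1 z, t2 z) + w" "(s1 z, s2 z) + w"] by (simp add: dist_norm)
      also have "\<dots> \<le> L * ?d z"
        using norm_Pair_le[of "t1 z - s1 z" "t2 z - s2 z"] L0 by (intro mult_left_mono) simp_all
      finally have "pd ((t1 z, t2 z) + w) \<le> pd ((s1 z, s2 z) + w) + L * ?d z" by linarith
      then have "ennreal (pd ((t1 z, t2 z) + w)) \<le> ennreal (pd ((s1 z, s2 z) + w)) + ennreal L * ennreal (?d z)"
        using L0 pd0 by (simp flip: ennreal_mult ennreal_plus)
      then have "ennreal (pd ((t1 z, t2 z) + w)) * f w \<le> (ennreal (pd ((s1 z, s2 z) + w)) + ennreal L * ennreal (?d z)) * f w"
        by (rule mult_right_mono) simp
      also have "\<dots> \<le> ennreal (pd ((s1 z, s2 z) + w)) * f w + ennreal L * ennreal (?d z) * 1"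
        unfolding distrib_right by (intro add_left_mono mult_left_mono f1) simp
      finally show ?thesis using True by simp
    qed simp
    then have "(\<integral>\<^sup>+w. ennreal (pd ((t1 z, t2 z) + w)) * ?g w \<partial>lborel) \<le>
      (\<integral>\<^sup>+w. ennreal (pd ((s1 z, s2 z) + w)) * f w + ennreal L * ennreal (?d z) * indicator ?K w \<partial>lborel)"
      by (rule nn_integral_mono)
    also have "\<dots> = (\<integral>\<^sup>+w. ennreal (pd ((s1 z, s2 z) + w)) * f w \<partial>lborel) + ennreal L * ennreal (?d z) * emeasure lborel ?K"
      by (subst nn_integral_add) (auto simp: nn_integral_cmult)
    finally show "(\<integral>\<^sup>+w. ennreal (pd ((t1 z, t2 z) + w)) * ?g w \<partial>lborel) \<le>
      (\<integral>\<^sup>+w. ennreal (pd ((s1 z, s2 z) + w)) * f w \<partial>lborel) + ennreal L * ennreal (?d z) * emeasure lborel ?K" .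
  qed
  also have "\<dots> = (\<integral>\<^sup>+z. \<integral>\<^sup>+w. ennreal (pd ((s1 z, s2 z) + w)) * f w \<partial>lborel \<partial>PZ)
      + (\<integral>\<^sup>+z. ennreal L * emeasure lborel ?K * ennreal (?d z) \<partial>PZ)"
    by (subst nn_integral_add) (auto simp: ac_simps)
  also have "(\<integral>\<^sup>+z. ennreal L * emeasure lborel ?K * ennreal (?d z) \<partial>PZ) =
      ennreal L * emeasure lborel ?K * (\<integral>\<^sup>+z. ennreal (norm (t1 z - s1 z)) + ennreal (norm (t2 z - s2 z)) \<partial>PZ)"
    by (subst nn_integral_cmult) auto
  also have "(\<integral>\<^sup>+z. \<integral>\<^sup>+w. ennreal (pd ((s1 z, s2 z) + w)) * f w \<partial>lborel \<partial>PZ) = (\<integral>\<^sup>+w. f w \<partial>shifted_noise_law PZ PN s1 s2)"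
    unfolding nn_integral_shifted_noise_law[OF PN setsPN s f]
    by (simp only: dens nn_integral_density_shift[OF pd f])
  finally show ?thesis .
qed

text \<open>One coordinate is exchanged at a time, at cost c each. Once the last coordinate has been
  integrated under N, the result is again a function of the others bounded by 1, so the induction
  hypothesis applies to it. Asking \<open>le\<close> for all functions bounded by 1 keeps the errors
  additive and the comparison one-sided.\<close>

lemma nn_integral_PiM_le:
  fixes c :: ennreal
  assumes M: "prob_space M" and N: "prob_space N" and sets: "sets M = sets N"
    and le: "\<And>f. f \<in> borel_measurable M \<Longrightarrow> (\<And>x. f x \<le> 1) \<Longrightarrow> (\<integral>\<^sup>+x. f x \<partial>M) \<le> (\<integral>\<^sup>+x. f x \<partial>N) + c"
    and f: "f \<in> borel_measurable (PiM {..<n::nat} (\<lambda>_. M))" and f1: "\<And>x. f x \<le> 1"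
  shows "(\<integral>\<^sup>+x. f x \<partial>PiM {..<n} (\<lambda>_. M)) \<le> (\<integral>\<^sup>+x. f x \<partial>PiM {..<n} (\<lambda>_. N)) + of_nat n * c"
  using f f1
proof (induction n arbitrary: f)
  case 0
  then show ?case by (simp add: PiM_empty)
next
  case (Suc n)
  interpret M: prob_space M by fact
  interpret N: prob_space N by fact
  interpret SM: product_sigma_finite "\<lambda>_::nat. M" by standard
  interpret SN: product_sigma_finite "\<lambda>_::nat. N" by standard
  interpret QM: prob_space "PiM {..<n} (\<lambda>_. M)" by (intro prob_space_PiM M)
  have ins: "{..<Suc n} = insert n {..<n}" by auto
  have setsP: "sets (PiM I (\<lambda>_. M)) = sets (PiM I (\<lambda>_. N))" for I :: "nat set"
    using sets by (intro sets_PiM_cong) auto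
  note [measurable] = Suc.prems(1)[unfolded ins]
  have fN [measurable]: "f \<in> borel_measurable (PiM (insert n {..<n}) (\<lambda>_. N))"
    using Suc.prems(1) setsP by (simp add: ins cong: measurable_cong_sets)
  have gN: "(\<lambda>D. \<integral>\<^sup>+y. f (D(n := y)) \<partial>N) \<in> borel_measurable (PiM {..<n} (\<lambda>_. N))"
    by measurable
  then have gM: "(\<lambda>D. \<integral>\<^sup>+y. f (D(n := y)) \<partial>N) \<in> borel_measurable (PiM {..<n} (\<lambda>_. M))"
    using setsP by (simp cong: measurable_cong_sets)
  have "(\<integral>\<^sup>+x. f x \<partial>PiM {..<Suc n} (\<lambda>_. M)) = (\<integral>\<^sup>+D. \<integral>\<^sup>+y. f (D(n := y)) \<partial>M \<partial>PiM {..<n} (\<lambda>_. M))"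
    unfolding ins by (rule SM.product_nn_integral_insert) auto
  also have "\<dots> \<le> (\<integral>\<^sup>+D. (\<integral>\<^sup>+y. f (D(n := y)) \<partial>N) + c \<partial>PiM {..<n} (\<lambda>_. M))"
    using Suc.prems(2) by (intro nn_integral_mono le) auto
  also have "\<dots> = (\<integral>\<^sup>+D. \<integral>\<^sup>+y. f (D(n := y)) \<partial>N \<partial>PiM {..<n} (\<lambda>_. M)) + c"
    using gM by (subst nn_integral_add) (auto simp: QM.emeasure_space_1)
  also have "\<dots> \<le> (\<integral>\<^sup>+D. \<integral>\<^sup>+y. f (D(n := y)) \<partial>N \<partial>PiM {..<n} (\<lambda>_. N)) + of_nat n * c + c"
  proof (intro add_right_mono Suc.IH gM)
    fix D
    have "(\<integral>\<^sup>+y. f (D(n := y)) \<partial>N) \<le> (\<integral>\<^sup>+y. 1 \<partial>N)"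
      by (intro nn_integral_mono Suc.prems(2))
    then show "(\<integral>\<^sup>+y. f (D(n := y)) \<partial>N) \<le> 1" by (simp add: N.emeasure_space_1)
  qed
  also have "(\<integral>\<^sup>+D. \<integral>\<^sup>+y. f (D(n := y)) \<partial>N \<partial>PiM {..<n} (\<lambda>_. N)) = (\<integral>\<^sup>+x. f x \<partial>PiM {..<Suc n} (\<lambda>_. N))"
    unfolding ins by (rule SN.product_nn_integral_insert[symmetric]) auto
  finally show ?case by (simp add: algebra_simps)
qed

text \<open>If one shift vanishes, Z enters the other component only and couples nothing. Agreement
  on rectangles identifies the two measures.\<close>

lemma shifted_noise_law_eq_product:
  fixes N1 :: "'x::euclidean_space measure" and N2 :: "'y::euclidean_space measure"
  assumes PZ: "prob_space PZ"
    and N1: "prob_space N1" "sets N1 = sets borel" and N2: "prob_space N2" "sets N2 = sets borel"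
    and s: "s1 \<in> borel_measurable PZ" "s2 \<in> borel_measurable PZ"
  shows "shifted_noise_law PZ (N1 \<Otimes>\<^sub>M N2) (\<lambda>z. 0) s2 = N1 \<Otimes>\<^sub>M distr (PZ \<Otimes>\<^sub>M N2) borel (\<lambda>(z, h). h - s2 z)" (is ?th1)
    and "shifted_noise_law PZ (N1 \<Otimes>\<^sub>M N2) s1 (\<lambda>z. 0) = distr (PZ \<Otimes>\<^sub>M N1) borel (\<lambda>(z, e). e - s1 z) \<Otimes>\<^sub>M N2" (is ?th2)
proof -
  interpret PZ: prob_space PZ by fact
  interpret N1: prob_space N1 by fact
  interpret N2: prob_space N2 by fact
  interpret Z1: pair_prob_space PZ N1 ..
  interpret Z2: pair_prob_space PZ N2 ..
  interpret N: pair_prob_space N1 N2 ..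
  note [measurable] = s
  have [measurable_cong]: "sets N1 = sets borel" "sets N2 = sets borel" by fact+
  have m1: "(\<lambda>(z, e). e - s1 z) \<in> PZ \<Otimes>\<^sub>M N1 \<rightarrow>\<^sub>M borel" by measurable
  have m2: "(\<lambda>(z, h). h - s2 z) \<in> PZ \<Otimes>\<^sub>M N2 \<rightarrow>\<^sub>M borel" by measurable
  interpret D1: prob_space "distr (PZ \<Otimes>\<^sub>M N1) borel (\<lambda>(z, e). e - s1 z)" by (rule Z1.P.prob_space_distr[OF m1])
  interpret D2: prob_space "distr (PZ \<Otimes>\<^sub>M N2) borel (\<lambda>(z, h). h - s2 z)" by (rule Z2.P.prob_space_distr[OF m2])
  have setsN: "sets (N1 \<Otimes>\<^sub>M N2) = sets borel"
    using N1 N2 by (metis borel_prod sets_pair_measure_cong)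
  \<comment> \<open>Given z, the probability of a rectangle factors. If one shift is zero, its
    factor is constant in z and leaves the outer integral.\<close>
  have law: "emeasure (shifted_noise_law PZ (N1 \<Otimes>\<^sub>M N2) u1 u2) (A \<times> B) =
      (\<integral>\<^sup>+z. \<integral>\<^sup>+e. indicator A (e - u1 z) \<partial>N1 * \<integral>\<^sup>+h. indicator B (h - u2 z) \<partial>N2 \<partial>PZ)"
    if "A \<in> sets borel" "B \<in> sets borel" and u: "u1 \<in> borel_measurable PZ" "u2 \<in> borel_measurable PZ" for u1 u2 A B
  proof -
    note [measurable] = that
    have AB: "A \<times> B \<in> sets borel" using that by (simp add: borel_Times)
    have "emeasure (shifted_noise_law PZ (N1 \<Otimes>\<^sub>M N2) u1 u2) (A \<times> B) =
        (\<integral>\<^sup>+w. indicator (A \<times> B) w \<partial>shifted_noise_law PZ (N1 \<Otimes>\<^sub>M N2) u1 u2)"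
      using AB by simp
    also have "\<dots> = (\<integral>\<^sup>+z. \<integral>\<^sup>+v. indicator (A \<times> B) (v - (u1 z, u2 z)) \<partial>(N1 \<Otimes>\<^sub>M N2) \<partial>PZ)"
      using AB by (intro nn_integral_shifted_noise_law setsN u N.prob_space_axioms) simp
    also have "\<dots> = (\<integral>\<^sup>+z. \<integral>\<^sup>+v. indicator A (fst v - u1 z) * indicator B (snd v - u2 z) \<partial>(N1 \<Otimes>\<^sub>M N2) \<partial>PZ)"
      by (intro nn_integral_cong) (auto simp: indicator_def split: if_splits)
    also have "\<dots> = (\<integral>\<^sup>+z. \<integral>\<^sup>+e. \<integral>\<^sup>+h. indicator A (e - u1 z) * indicator B (h - u2 z) \<partial>N2 \<partial>N1 \<partial>PZ)"
      by (intro nn_integral_cong, subst N2.nn_integral_fst[symmetric]) auto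
    also have "\<dots> = (\<integral>\<^sup>+z. \<integral>\<^sup>+e. indicator A (e - u1 z) \<partial>N1 * \<integral>\<^sup>+h. indicator B (h - u2 z) \<partial>N2 \<partial>PZ)"
      by (intro nn_integral_cong) (simp add: nn_integral_cmult nn_integral_multc)
    finally show ?thesis .
  qed
  have em1: "emeasure (distr (PZ \<Otimes>\<^sub>M N1) borel (\<lambda>(z, e). e - s1 z)) A = (\<integral>\<^sup>+z. \<integral>\<^sup>+e. indicator A (e - s1 z) \<partial>N1 \<partial>PZ)"
    if [measurable]: "A \<in> sets borel" for A
  proof -
    have "emeasure (distr (PZ \<Otimes>\<^sub>M N1) borel (\<lambda>(z, e). e - s1 z)) A = (\<integral>\<^sup>+u. indicator A ((\<lambda>(z, e). e - s1 z) u) \<partial>(PZ \<Otimes>\<^sub>M N1))"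
      using nn_integral_distr[OF m1, of "indicator A"] that by simp
    also have "\<dots> = (\<integral>\<^sup>+z. \<integral>\<^sup>+e. indicator A (e - s1 z) \<partial>N1 \<partial>PZ)"
      by (subst N1.nn_integral_fst[symmetric]) auto
    finally show ?thesis .
  qed
  have em2: "emeasure (distr (PZ \<Otimes>\<^sub>M N2) borel (\<lambda>(z, h). h - s2 z)) A = (\<integral>\<^sup>+z. \<integral>\<^sup>+h. indicator A (h - s2 z) \<partial>N2 \<partial>PZ)"
    if [measurable]: "A \<in> sets borel" for A
  proof -
    have "emeasure (distr (PZ \<Otimes>\<^sub>M N2) borel (\<lambda>(z, h). h - s2 z)) A = (\<integral>\<^sup>+u. indicator A ((\<lambda>(z, h). h - s2 z) u) \<partial>(PZ \<Otimes>\<^sub>M N2))"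
      using nn_integral_distr[OF m2, of "indicator A"] that by simp
    also have "\<dots> = (\<integral>\<^sup>+z. \<integral>\<^sup>+h. indicator A (h - s2 z) \<partial>N2 \<partial>PZ)"
      by (subst N2.nn_integral_fst[symmetric]) auto
    finally show ?thesis .
  qed
  show ?th1
  proof (rule sym, rule pair_measure_eqI)
    show "sets (N1 \<Otimes>\<^sub>M distr (PZ \<Otimes>\<^sub>M N2) borel (\<lambda>(z, h). h - s2 z)) = sets (shifted_noise_law PZ (N1 \<Otimes>\<^sub>M N2) (\<lambda>z. 0) s2)"
      using N1(2) by (metis borel_prod sets_distr sets_pair_measure_cong sets_shifted_noise_law)
  next
    fix A B assume AB: "A \<in> sets N1" "B \<in> sets (distr (PZ \<Otimes>\<^sub>M N2) borel (\<lambda>(z, h). h - s2 z))"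
    then have [measurable]: "A \<in> sets borel" "B \<in> sets borel" using N1(2) by auto
    have "emeasure (shifted_noise_law PZ (N1 \<Otimes>\<^sub>M N2) (\<lambda>z. 0) s2) (A \<times> B) =
      (\<integral>\<^sup>+z. emeasure N1 A * \<integral>\<^sup>+h. indicator B (h - s2 z) \<partial>N2 \<partial>PZ)"
      using AB(1) by (subst law) auto
    then show "emeasure N1 A * emeasure (distr (PZ \<Otimes>\<^sub>M N2) borel (\<lambda>(z, h). h - s2 z)) B =
      emeasure (shifted_noise_law PZ (N1 \<Otimes>\<^sub>M N2) (\<lambda>z. 0) s2) (A \<times> B)"
      by (simp add: em2 nn_integral_cmult)
  qed unfold_locales
  show ?th2
  proof (rule sym, rule pair_measure_eqI)
    show "sets (distr (PZ \<Otimes>\<^sub>M N1) borel (\<lambda>(z, e). e - s1 z) \<Otimes>\<^sub>M N2) = sets (shifted_noise_law PZ (N1 \<Otimes>\<^sub>M N2) s1 (\<lambda>z. 0))"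
      using N2(2) by (metis borel_prod sets_distr sets_pair_measure_cong sets_shifted_noise_law)
  next
    fix A B assume AB: "A \<in> sets (distr (PZ \<Otimes>\<^sub>M N1) borel (\<lambda>(z, e). e - s1 z))" "B \<in> sets N2"
    then have [measurable]: "A \<in> sets borel" "B \<in> sets borel" using N2(2) by auto
    have "emeasure (shifted_noise_law PZ (N1 \<Otimes>\<^sub>M N2) s1 (\<lambda>z. 0)) (A \<times> B) =
      (\<integral>\<^sup>+z. (\<integral>\<^sup>+e. indicator A (e - s1 z) \<partial>N1) * emeasure N2 B \<partial>PZ)"
      using AB(2) by (subst law) auto
    then show "emeasure (distr (PZ \<Otimes>\<^sub>M N1) borel (\<lambda>(z, e). e - s1 z)) A * emeasure N2 B =
      emeasure (shifted_noise_law PZ (N1 \<Otimes>\<^sub>M N2) s1 (\<lambda>z. 0)) (A \<times> B)"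
      by (simp add: em1 nn_integral_multc)
  qed unfold_locales
qed

subsection \<open>The rejection probability for a fixed distribution\<close>

lemma sets_anm_law [simp]: "sets (anm_law MZ PZ PN f1 f2) = sets (borel \<Otimes>\<^sub>M borel \<Otimes>\<^sub>M MZ)"
  by (simp add: anm_law_def)

lemma measurable_anm:
  fixes f1 :: "'z \<Rightarrow> 'x::euclidean_space" and f2 :: "'z \<Rightarrow> 'y::euclidean_space"
  assumes PZ: "sets PZ = sets MZ" and PN: "sets PN = sets borel"
    and f [measurable]: "f1 \<in> borel_measurable MZ" "f2 \<in> borel_measurable MZ"
  shows "(\<lambda>(z, e, h). (f1 z + e, f2 z + h, z)) \<in> PZ \<Otimes>\<^sub>M PN \<rightarrow>\<^sub>M borel \<Otimes>\<^sub>M borel \<Otimes>\<^sub>M MZ"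
proof -
  have "sets (PZ \<Otimes>\<^sub>M PN) = sets (MZ \<Otimes>\<^sub>M (borel \<Otimes>\<^sub>M borel))"
    unfolding borel_prod using PZ PN by (intro sets_pair_measure_cong)
  moreover have "(\<lambda>(z, e, h). (f1 z + e, f2 z + h, z)) \<in> MZ \<Otimes>\<^sub>M (borel \<Otimes>\<^sub>M borel) \<rightarrow>\<^sub>M borel \<Otimes>\<^sub>M borel \<Otimes>\<^sub>M MZ"
    by measurable
  ultimately show ?thesis by (simp cong: measurable_cong_sets)
qed

lemma prob_space_anm_law:
  assumes "prob_space PZ" "prob_space PN" "sets PZ = sets MZ" "sets PN = sets borel"
    and "f1 \<in> borel_measurable MZ" "f2 \<in> borel_measurable MZ"
  shows "prob_space (anm_law MZ PZ PN f1 f2)"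
proof -
  interpret pair_prob_space PZ PN
    using assms by (simp add: pair_prob_space_def pair_sigma_finite_def prob_space_imp_sigma_finite)
  show ?thesis unfolding anm_law_def
    by (rule P.prob_space_distr) (rule measurable_anm[OF assms(3-6)])
qed

text \<open>Since X - g1 Z = e - (g1 Z - f1 Z), and likewise for Y, the regression functions enter
  the residuals only through the error of the model.\<close>

lemma distr_anm_law_resid:
  fixes f1 g1 :: "'z \<Rightarrow> 'x::euclidean_space" and f2 g2 :: "'z \<Rightarrow> 'y::euclidean_space"
  assumes PZ: "sets PZ = sets MZ" and PN: "sets PN = sets borel"
    and f: "f1 \<in> borel_measurable MZ" "f2 \<in> borel_measurable MZ"
    and g [measurable]: "g1 \<in> borel_measurable MZ" "g2 \<in> borel_measurable MZ"
  shows "distr (anm_law MZ PZ PN f1 f2) borel (\<lambda>d. (fst d - g1 (snd (snd d)), fst (snd d) - g2 (snd (snd d)))) =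
    shifted_noise_law PZ PN (\<lambda>z. g1 z - f1 z) (\<lambda>z. g2 z - f2 z)"
proof -
  have "(\<lambda>d. (fst d - g1 (snd (snd d)), fst (snd d) - g2 (snd (snd d)))) \<in>
      borel \<Otimes>\<^sub>M borel \<Otimes>\<^sub>M MZ \<rightarrow>\<^sub>M (borel :: ('x \<times> 'y) measure)"
    unfolding borel_prod[symmetric] by measurable
  from distr_distr[OF this measurable_anm[OF PZ PN f]] show ?thesis
    unfolding anm_law_def shifted_noise_law_def
    by (auto intro!: distr_cong simp: algebra_simps)
qed

text \<open>The models are fixed functions here, as they are once the training set is given. The
  residual map acts on each row separately and so carries a product law to a product law.\<close>

lemma nn_integral_resid_rows:
  fixes f1 g1 :: "'z \<Rightarrow> 'x::euclidean_space" and f2 g2 :: "'z \<Rightarrow> 'y::euclidean_space"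
  assumes PZ: "prob_space PZ" "sets PZ = sets MZ" and PN: "prob_space PN" "sets PN = sets borel"
    and f: "f1 \<in> borel_measurable MZ" "f2 \<in> borel_measurable MZ"
    and g [measurable]: "g1 \<in> borel_measurable MZ" "g2 \<in> borel_measurable MZ"
    and F: "F \<in> borel_measurable (PiM {..<n} (\<lambda>_. borel))"
  shows "(\<integral>\<^sup>+te. F (resid_rows n g1 g2 te) \<partial>PiM {..<n} (\<lambda>_. anm_law MZ PZ PN f1 f2)) =
    (\<integral>\<^sup>+R. F R \<partial>PiM {..<n} (\<lambda>_. shifted_noise_law PZ PN (\<lambda>z. g1 z - f1 z) (\<lambda>z. g2 z - f2 z)))"
proof -
  let ?P = "anm_law MZ PZ PN f1 f2"
  let ?h = "\<lambda>d :: 'x \<times> 'y \<times> 'z. (fst d - g1 (snd (snd d)), fst (snd d) - g2 (snd (snd d)))"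
  let ?Q = "shifted_noise_law PZ PN (\<lambda>z. g1 z - f1 z) (\<lambda>z. g2 z - f2 z)"
  have P: "prob_space ?P" by (rule prob_space_anm_law[OF PZ(1) PN(1) PZ(2) PN(2) f])
  have "f1 \<in> borel_measurable PZ" "f2 \<in> borel_measurable PZ" "g1 \<in> borel_measurable PZ" "g2 \<in> borel_measurable PZ"
    using f g PZ(2) by (simp_all cong: measurable_cong_sets)
  then have Q: "prob_space ?Q" using PZ PN by (intro prob_space_shifted_noise_law) auto
  have "?h \<in> borel \<Otimes>\<^sub>M borel \<Otimes>\<^sub>M MZ \<rightarrow>\<^sub>M (borel :: ('x \<times> 'y) measure)"
    unfolding borel_prod[symmetric] by measurable
  then have hb: "?h \<in> ?P \<rightarrow>\<^sub>M borel" by (simp cong: measurable_cong_sets)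
  then have h: "?h \<in> ?P \<rightarrow>\<^sub>M ?Q" by (simp cong: measurable_cong_sets)
  have eq: "resid_rows n g1 g2 = compose {..<n} ?h"
    by (auto simp: resid_rows_def compose_def fun_eq_iff)
  have "distr ?P ?Q ?h = distr ?P borel ?h"
    by (rule distr_cong) auto
  then have "distr ?P ?Q ?h = ?Q"
    by (simp only: distr_anm_law_resid[OF PZ(2) PN(2) f g])
  then have d: "distr (PiM {..<n} (\<lambda>_. ?P)) (PiM {..<n} (\<lambda>_. ?Q)) (compose {..<n} ?h) = PiM {..<n} (\<lambda>_. ?Q)"
    using distr_PiM_finite_prob_space'[of "{..<n}" "\<lambda>_. ?P" "\<lambda>_. ?Q" ?h] P Q h by simp
  have cm: "compose {..<n} ?h \<in> PiM {..<n} (\<lambda>_. ?P) \<rightarrow>\<^sub>M PiM {..<n} (\<lambda>_. ?Q)"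
    unfolding compose_def
    by (intro measurable_restrict measurable_compose[OF _ h] measurable_component_singleton)
  have "sets (PiM {..<n} (\<lambda>_. ?Q)) = sets (PiM {..<n} (\<lambda>_. borel))"
    by (intro sets_PiM_cong) auto
  then have F': "F \<in> borel_measurable (PiM {..<n} (\<lambda>_. ?Q))"
    using F by (simp cong: measurable_cong_sets)
  have "(\<integral>\<^sup>+R. F R \<partial>PiM {..<n} (\<lambda>_. ?Q)) =
    (\<integral>\<^sup>+R. F R \<partial>distr (PiM {..<n} (\<lambda>_. ?P)) (PiM {..<n} (\<lambda>_. ?Q)) (compose {..<n} ?h))"
    by (simp only: d)
  also have "\<dots> = (\<integral>\<^sup>+te. F (resid_rows n g1 g2 te) \<partial>PiM {..<n} (\<lambda>_. ?P))"
    unfolding eq by (rule nn_integral_distr[OF cm]) (use F' in simp)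
  finally show ?thesis ..
qed

text \<open>The residual is \<open>(X, Y)\<close> minus the pair of model values, and both points
  lie in \<open>A\<close> almost surely; hence twice the radius. The condition on the models
  concerns \<open>PZ\<close> alone and has to be lifted to the joint law of Z and the noise.\<close>

lemma AE_norm_shifted_noise_law_le:
  fixes f1 g1 :: "'z \<Rightarrow> 'x::euclidean_space" and f2 g2 :: "'z \<Rightarrow> 'y::euclidean_space"
  assumes PZ: "prob_space PZ" "sets PZ = sets MZ" and PN: "prob_space PN" "sets PN = sets borel"
    and f: "f1 \<in> borel_measurable MZ" "f2 \<in> borel_measurable MZ"
    and g: "g1 \<in> borel_measurable MZ" "g2 \<in> borel_measurable MZ"
    and A: "A \<in> sets borel" "\<And>a. a \<in> A \<Longrightarrow> norm a \<le> r"
    and XY: "AE d in anm_law MZ PZ PN f1 f2. (fst d, fst (snd d)) \<in> A"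
    and G: "AE z in PZ. (g1 z, g2 z) \<in> A"
  shows "AE w in shifted_noise_law PZ PN (\<lambda>z. g1 z - f1 z) (\<lambda>z. g2 z - f2 z). norm w \<le> 2 * r"
proof -
  interpret pair_prob_space PZ PN
    using PZ PN by (simp add: pair_prob_space_def pair_sigma_finite_def prob_space_imp_sigma_finite)
  have [measurable]: "f1 \<in> borel_measurable PZ" "f2 \<in> borel_measurable PZ" "g1 \<in> borel_measurable PZ" "g2 \<in> borel_measurable PZ"
    using f g PZ(2) by (simp_all cong: measurable_cong_sets)
  have XY': "AE u in PZ \<Otimes>\<^sub>M PN. (f1 (fst u) + fst (snd u), f2 (fst u) + snd (snd u)) \<in> A"
    using AE_distrD[OF measurable_anm[OF PZ(2) PN(2) f] XY[unfolded anm_law_def]]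
    by (simp add: case_prod_beta)
  have "(\<lambda>u. (g1 (fst u), g2 (fst u))) \<in> PZ \<Otimes>\<^sub>M PN \<rightarrow>\<^sub>M (borel :: ('x \<times> 'y) measure)"
    unfolding borel_prod[symmetric] by measurable
  from measurable_sets[OF this A(1)]
  have "{u \<in> space (PZ \<Otimes>\<^sub>M PN). (g1 (fst u), g2 (fst u)) \<in> A} \<in> sets (PZ \<Otimes>\<^sub>M PN)"
    by (simp add: vimage_def Int_def conj_commute)
  then have G': "AE u in PZ \<Otimes>\<^sub>M PN. (g1 (fst u), g2 (fst u)) \<in> A"
    using G by (intro AE_pair_measure) auto
  have "AE u in PZ \<Otimes>\<^sub>M PN. norm (case u of (z, e, h) \<Rightarrow> (e - (g1 z - f1 z), h - (g2 z - f2 z))) \<le> 2 * r"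
    using XY' G'
  proof eventually_elim
    case (elim u)
    obtain z e h where u: "u = (z, e, h)" by (cases u) auto
    have "norm ((f1 z + e, f2 z + h) - (g1 z, g2 z)) \<le> norm (f1 z + e, f2 z + h) + norm (g1 z, g2 z)"
      by (rule norm_triangle_ineq4)
    also have "\<dots> \<le> 2 * r" using A(2)[of "(f1 z + e, f2 z + h)"] A(2)[of "(g1 z, g2 z)"] elim u by simp
    finally show ?case by (simp add: u algebra_simps)
  qed
  then show ?thesis
    unfolding shifted_noise_law_def
    by (subst AE_distr_iff) (auto intro!: measurable_shift PN(2))
qed

text \<open>The elementary bound \<open>u \<le> u\<^sup>2 / (2 t) + t / 2\<close> replaces the Cauchy-Schwarz inequality.\<close>

lemma nn_integral_le_of_nn_integral_square:
  fixes u :: "'a \<Rightarrow> real"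
  assumes M: "prob_space M" and u [measurable]: "u \<in> borel_measurable M"
    and t: "t > 0" and K: "K \<ge> 0"
    and sq: "(\<integral>\<^sup>+x. ennreal ((u x)\<^sup>2) \<partial>M) \<le> ennreal (K * t\<^sup>2)"
  shows "(\<integral>\<^sup>+x. ennreal (u x) \<partial>M) \<le> ennreal ((K + 1) / 2 * t)"
proof -
  interpret prob_space M by fact
  have "(\<integral>\<^sup>+x. ennreal (u x) \<partial>M) \<le> (\<integral>\<^sup>+x. ennreal (1 / (2 * t)) * ennreal ((u x)\<^sup>2) + ennreal (t / 2) \<partial>M)"
  proof (rule nn_integral_mono)
    fix x
    have "0 \<le> (u x - t)\<^sup>2" by simp
    then have "u x \<le> 1 / (2 * t) * (u x)\<^sup>2 + t / 2"
      using t by (simp add: field_simps power2_eq_square)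
    then show "ennreal (u x) \<le> ennreal (1 / (2 * t)) * ennreal ((u x)\<^sup>2) + ennreal (t / 2)"
      using t by (simp add: ennreal_leI flip: ennreal_mult ennreal_plus)
  qed
  also have "\<dots> = ennreal (1 / (2 * t)) * (\<integral>\<^sup>+x. ennreal ((u x)\<^sup>2) \<partial>M) + ennreal (t / 2)"
    by (subst nn_integral_add) (auto simp: nn_integral_cmult emeasure_space_1)
  also have "\<dots> \<le> ennreal (1 / (2 * t)) * ennreal (K * t\<^sup>2) + ennreal (t / 2)"
    by (intro add_right_mono mult_left_mono sq) simp
  also have "\<dots> = ennreal (1 / (2 * t) * (K * t\<^sup>2) + t / 2)"
    using t K by (simp flip: ennreal_mult ennreal_plus)
  also have "1 / (2 * t) * (K * t\<^sup>2) + t / 2 = (K + 1) / 2 * t"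
    using t by (simp add: field_simps power2_eq_square)
  finally show ?thesis .
qed

text \<open>In the application \<open>t\<close> is \<open>m powr (- \<gamma> / 2)\<close>, so that
  \<open>K1 * t\<^sup>2\<close> and \<open>K2 * t\<^sup>2\<close> are the thresholds of (S1). On the
  exceptional training sets \<open>E1\<close> and \<open>E2\<close> the rejection probability is
  bounded by 1. Elsewhere the mean errors of the two models are at most (K1 + 1) / 2 * t and (K2 +
  1) / 2 * t, which add up to the factor (K1 + K2 + 2) / 2 * t. The error of the n rows involves
  only n, L, r, K1, K2 and t, which is what makes it uniform over the distributions.\<close>

lemma resit_rejection_prob_le:
  fixes f1 g1s :: "'z \<Rightarrow> 'x::euclidean_space" and f2 g2s :: "'z \<Rightarrow> 'y::euclidean_space"
    and g1hat :: "nat \<Rightarrow> (nat \<Rightarrow> 'x \<times> 'y \<times> 'z) \<Rightarrow> 'z \<Rightarrow> 'x"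
    and g2hat :: "nat \<Rightarrow> (nat \<Rightarrow> 'x \<times> 'y \<times> 'z) \<Rightarrow> 'z \<Rightarrow> 'y"
  assumes PZ: "prob_space PZ" "sets PZ = sets MZ" and PN: "prob_space PN"
    and dens: "PN = density lborel (\<lambda>v. ennreal (pd v))"
    and pd: "pd \<in> borel_measurable borel" "\<And>v. pd v \<ge> 0" "L-lipschitz_on UNIV pd"
    and f: "f1 \<in> borel_measurable MZ" "f2 \<in> borel_measurable MZ"
    and gs: "g1s \<in> borel_measurable MZ" "g2s \<in> borel_measurable MZ"
    and gh1: "(\<lambda>(tr, z). g1hat m tr z)
          \<in> borel_measurable (PiM {..<m} (\<lambda>_. borel \<Otimes>\<^sub>M borel \<Otimes>\<^sub>M MZ) \<Otimes>\<^sub>M MZ)"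
    and gh2: "(\<lambda>(tr, z). g2hat m tr z)
          \<in> borel_measurable (PiM {..<m} (\<lambda>_. borel \<Otimes>\<^sub>M borel \<Otimes>\<^sub>M MZ) \<Otimes>\<^sub>M MZ)"
    and A: "A \<in> sets borel" "\<And>a. a \<in> A \<Longrightarrow> norm a \<le> r"
    and XY: "AE d in anm_law MZ PZ PN f1 f2. (fst d, fst (snd d)) \<in> A"
    and G: "\<And>tr. AE z in PZ. (g1hat m tr z, g2hat m tr z) \<in> A"
    and \<Psi>: "\<Psi> n \<in> borel_measurable (PiM {..<n} (\<lambda>_. borel))"
    and t: "t > 0" and K: "K1 \<ge> 0" "K2 \<ge> 0"
  defines "P \<equiv> anm_law MZ PZ PN f1 f2"
  defines "E1 \<equiv> {tr \<in> space (PiM {..<m} (\<lambda>_. P)). (\<integral>\<^sup>+z. ennreal ((norm (g1hat m tr z - g1s z))\<^sup>2) \<partial>PZ) > ennreal (K1 * t\<^sup>2)}"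
    and "E2 \<equiv> {tr \<in> space (PiM {..<m} (\<lambda>_. P)). (\<integral>\<^sup>+z. ennreal ((norm (g2hat m tr z - g2s z))\<^sup>2) \<partial>PZ) > ennreal (K2 * t\<^sup>2)}"
  shows "resit_rejection_prob n m B \<Psi> \<alpha> g1hat g2hat P \<le>
     (\<integral>R. resit_cond_reject n B (\<Psi> n) \<alpha> R
        \<partial>PiM {..<n} (\<lambda>_. shifted_noise_law PZ PN (\<lambda>z. g1s z - f1 z) (\<lambda>z. g2s z - f2 z)))
     + real n * (L * measure lborel (cball (0 :: 'x \<times> 'y) (2 * r)) * ((K1 + K2 + 2) / 2 * t))
     + measure (PiM {..<m} (\<lambda>_. P)) E1 + measure (PiM {..<m} (\<lambda>_. P)) E2"
proof -
  have setsPN: "sets PN = sets borel" using dens by simp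
  have P: "prob_space P" unfolding P_def by (rule prob_space_anm_law[OF PZ(1) PN PZ(2) setsPN f])
  define Te where "Te = PiM {..<n} (\<lambda>_. P)"
  define Tr where "Tr = PiM {..<m} (\<lambda>_. P)"
  let ?Q = "\<lambda>u1 u2. shifted_noise_law PZ PN (\<lambda>z. u1 z - f1 z) (\<lambda>z. u2 z - f2 z)"
  let ?r = "resit_cond_reject n B (\<Psi> n) \<alpha>"
  interpret PZ: prob_space PZ by fact
  interpret Te: prob_space Te unfolding Te_def by (intro prob_space_PiM P)
  interpret Tr: prob_space Tr unfolding Tr_def by (intro prob_space_PiM P)
  interpret TT: pair_prob_space Te Tr ..
  have setsT: "sets Te = sets (PiM {..<n} (\<lambda>_. borel \<Otimes>\<^sub>M borel \<Otimes>\<^sub>M MZ))" "sets Tr = sets (PiM {..<m} (\<lambda>_. borel \<Otimes>\<^sub>M borel \<Otimes>\<^sub>M MZ))"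
    unfolding Te_def Tr_def by (auto intro!: sets_PiM_cong simp: P_def)
  have setsTrMZ: "sets (Tr \<Otimes>\<^sub>M PZ) = sets (PiM {..<m} (\<lambda>_. borel \<Otimes>\<^sub>M borel \<Otimes>\<^sub>M MZ) \<Otimes>\<^sub>M MZ)"
    by (intro sets_pair_measure_cong setsT PZ)
  have gh1' [measurable]: "(\<lambda>u. g1hat m (fst u) (snd u)) \<in> borel_measurable (Tr \<Otimes>\<^sub>M PZ)"
    using gh1 setsTrMZ by (simp add: case_prod_beta cong: measurable_cong_sets)
  have gh2' [measurable]: "(\<lambda>u. g2hat m (fst u) (snd u)) \<in> borel_measurable (Tr \<Otimes>\<^sub>M PZ)"
    using gh2 setsTrMZ by (simp add: case_prod_beta cong: measurable_cong_sets)
  have toPZ: "u \<in> borel_measurable PZ \<longleftrightarrow> u \<in> borel_measurable MZ" for u :: "'z \<Rightarrow> 'b::euclidean_space"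
    using PZ(2) by (simp cong: measurable_cong_sets)
  have [measurable]: "f1 \<in> borel_measurable PZ" "f2 \<in> borel_measurable PZ"
    "g1s \<in> borel_measurable PZ" "g2s \<in> borel_measurable PZ"
    using f gs toPZ by auto
  have ghPZ [measurable]: "g1hat m tr \<in> borel_measurable PZ" "g2hat m tr \<in> borel_measurable PZ" if "tr \<in> space Tr" for tr
    using measurable_Pair2[OF gh1' that] measurable_Pair2[OF gh2' that] by simp_all
  have E: "E1 \<in> sets Tr" "E2 \<in> sets Tr"
    unfolding E1_def E2_def Tr_def[symmetric] by measurable
  have rm: "?r \<in> borel_measurable (PiM {..<n} (\<lambda>_. borel))"
    by (rule measurable_resit_cond_reject[where ?\<Psi> = "\<Psi> n" and n = n, OF \<Psi>])
  have "sets (PiM {..<n} (\<lambda>_. ?Q u1 u2)) = sets (PiM {..<n} (\<lambda>_. borel))" for u1 u2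
    by (intro sets_PiM_cong) auto
  then have rm': "?r \<in> borel_measurable (PiM {..<n} (\<lambda>_. ?Q u1 u2))" for u1 u2
    using rm by (simp cong: measurable_cong_sets)
  have resid: "(\<lambda>d. resid_rows n (g1hat m (snd d)) (g2hat m (snd d)) (fst d)) \<in> Te \<Otimes>\<^sub>M Tr \<rightarrow>\<^sub>M
      PiM {..<n} (\<lambda>_. borel :: ('x \<times> 'y) measure)"
    unfolding resid_rows_def
  proof (rule measurable_restrict)
    fix i assume i: "i \<in> {..<n}"
    have [measurable]: "(\<lambda>te. te i) \<in> Te \<rightarrow>\<^sub>M borel \<Otimes>\<^sub>M borel \<Otimes>\<^sub>M MZ"
      using measurable_component_singleton[OF i, of "\<lambda>_. borel \<Otimes>\<^sub>M borel \<Otimes>\<^sub>M MZ"] setsT(1)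
      by (simp cong: measurable_cong_sets)
    have z: "(\<lambda>d. snd (snd (fst d i))) \<in> Te \<Otimes>\<^sub>M Tr \<rightarrow>\<^sub>M MZ" by measurable
    then have [measurable]: "(\<lambda>d. snd (snd (fst d i))) \<in> Te \<Otimes>\<^sub>M Tr \<rightarrow>\<^sub>M PZ"
      using PZ(2) by (simp cong: measurable_cong_sets)
    have pr: "(\<lambda>d. (snd d, snd (snd (fst d i)))) \<in> Te \<Otimes>\<^sub>M Tr \<rightarrow>\<^sub>M Tr \<Otimes>\<^sub>M PZ" by measurable
    have [measurable]: "(\<lambda>d. g1hat m (snd d) (snd (snd (fst d i)))) \<in> borel_measurable (Te \<Otimes>\<^sub>M Tr)"
      "(\<lambda>d. g2hat m (snd d) (snd (snd (fst d i)))) \<in> borel_measurable (Te \<Otimes>\<^sub>M Tr)"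
      using measurable_compose[OF pr gh1'] measurable_compose[OF pr gh2'] by simp_all
    show "(\<lambda>d. (fst (fst d i) - g1hat m (snd d) (snd (snd (fst d i))),
         fst (snd (fst d i)) - g2hat m (snd d) (snd (snd (fst d i))))) \<in> Te \<Otimes>\<^sub>M Tr \<rightarrow>\<^sub>M (borel :: ('x \<times> 'y) measure)"
      unfolding borel_prod[symmetric] by measurable
  qed
  define V where "V = (\<integral>R. ?r R \<partial>PiM {..<n} (\<lambda>_. ?Q g1s g2s))"
  define c where "c = L * measure lborel (cball (0 :: 'x \<times> 'y) (2 * r)) * ((K1 + K2 + 2) / 2 * t)"
  have L0: "L \<ge> 0" using pd(3) by (rule lipschitz_on_nonneg)
  have Kt: "0 \<le> (K1 + K2 + 2) / 2 * t" using K t by simp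
  have c0: "c \<ge> 0" unfolding c_def by (rule mult_nonneg_nonneg[OF mult_nonneg_nonneg[OF L0 measure_nonneg] Kt])
  have Qs: "prob_space (?Q g1s g2s)" by (intro prob_space_shifted_noise_law PZ PN setsPN) auto
  have V0: "V \<ge> 0" unfolding V_def by (intro Bochner_Integration.integral_nonneg) (simp add: resit_cond_reject_bounds)
  have V: "(\<integral>\<^sup>+R. ennreal (?r R) \<partial>PiM {..<n} (\<lambda>_. ?Q g1s g2s)) = ennreal V"
    unfolding V_def
    by (intro nn_integral_eq_integral prob_space_integrable_bounded prob_space_PiM Qs rm') (auto simp: resit_cond_reject_bounds)
  \<comment> \<open>The indicators let one inequality serve good and bad training sets alike;
    integrated over \<open>tr\<close>, they become the probabilities of \<open>E1\<close> and
    \<open>E2\<close>.\<close>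
  have inner: "(\<integral>\<^sup>+te. ennreal (?r (resid_rows n (g1hat m tr) (g2hat m tr) te)) \<partial>Te) \<le>
      ennreal (V + real n * c) + indicator E1 tr + indicator E2 tr" if tr: "tr \<in> space Tr" for tr
  proof -
    note [measurable] = ghPZ[OF tr]
    have ghMZ: "g1hat m tr \<in> borel_measurable MZ" "g2hat m tr \<in> borel_measurable MZ"
      using ghPZ[OF tr] by (simp_all only: toPZ)
    have Qt: "prob_space (?Q (g1hat m tr) (g2hat m tr))"
      by (intro prob_space_shifted_noise_law PZ PN setsPN) auto
    have eq: "(\<integral>\<^sup>+te. ennreal (?r (resid_rows n (g1hat m tr) (g2hat m tr) te)) \<partial>Te) =
       (\<integral>\<^sup>+R. ennreal (?r R) \<partial>PiM {..<n} (\<lambda>_. ?Q (g1hat m tr) (g2hat m tr)))"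
      unfolding Te_def P_def by (rule nn_integral_resid_rows[OF PZ PN setsPN f ghMZ]) (use rm in measurable)
    show ?thesis
    proof (cases "tr \<in> E1 \<or> tr \<in> E2")
      case True
      interpret R: prob_space "PiM {..<n} (\<lambda>_. ?Q (g1hat m tr) (g2hat m tr))" by (intro prob_space_PiM Qt)
      have "(\<integral>\<^sup>+R. ennreal (?r R) \<partial>PiM {..<n} (\<lambda>_. ?Q (g1hat m tr) (g2hat m tr))) \<le>
          (\<integral>\<^sup>+R. 1 \<partial>PiM {..<n} (\<lambda>_. ?Q (g1hat m tr) (g2hat m tr)))"
        by (intro nn_integral_mono) (simp add: resit_cond_reject_bounds)
      also have "\<dots> = 1" by (simp add: R.emeasure_space_1)
      also have "1 \<le> indicator E1 tr + (indicator E2 tr :: ennreal)"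
        using True by (auto simp: indicator_def)
      also have "\<dots> \<le> ennreal (V + real n * c) + (indicator E1 tr + indicator E2 tr)"
        by simp
      finally show ?thesis unfolding eq by (simp add: add.assoc)
    next
      case False
      have b1: "(\<integral>\<^sup>+z. ennreal (norm (g1hat m tr z - g1s z)) \<partial>PZ) \<le> ennreal ((K1 + 1) / 2 * t)"
        using False tr t K by (intro nn_integral_le_of_nn_integral_square PZ) (auto simp: E1_def Tr_def)
      have b2: "(\<integral>\<^sup>+z. ennreal (norm (g2hat m tr z - g2s z)) \<partial>PZ) \<le> ennreal ((K2 + 1) / 2 * t)"
        using False tr t K by (intro nn_integral_le_of_nn_integral_square PZ) (auto simp: E2_def Tr_def)
      have "(\<integral>\<^sup>+z. ennreal (norm (g1hat m tr z - g1s z)) + ennreal (norm (g2hat m tr z - g2s z)) \<partial>PZ)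
          = (\<integral>\<^sup>+z. ennreal (norm (g1hat m tr z - g1s z)) \<partial>PZ) + (\<integral>\<^sup>+z. ennreal (norm (g2hat m tr z - g2s z)) \<partial>PZ)"
        by (intro nn_integral_add) auto
      also have "\<dots> \<le> ennreal ((K1 + 1) / 2 * t) + ennreal ((K2 + 1) / 2 * t)"
        by (intro add_mono b1 b2)
      also have "\<dots> = ennreal ((K1 + K2 + 2) / 2 * t)"
        using K t by (subst ennreal_plus[symmetric]) (auto simp: field_simps)
      finally have b: "(\<integral>\<^sup>+z. ennreal (norm (g1hat m tr z - g1s z)) + ennreal (norm (g2hat m tr z - g2s z)) \<partial>PZ)
          \<le> ennreal ((K1 + K2 + 2) / 2 * t)" .
      have supp: "AE w in ?Q (g1hat m tr) (g2hat m tr). norm w \<le> 2 * r"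
        by (rule AE_norm_shifted_noise_law_le[OF PZ PN setsPN f ghMZ A XY G])
      \<comment> \<open>The cost of a single row, for every function bounded by 1 as
        \<open>nn_integral_PiM_le\<close> requires. In the difference of the two shifts f1 and f2
        cancel, which leaves fitted minus limiting model.\<close>
      have one: "(\<integral>\<^sup>+w. F w \<partial>?Q (g1hat m tr) (g2hat m tr)) \<le> (\<integral>\<^sup>+w. F w \<partial>?Q g1s g2s) + ennreal c"
        if F: "F \<in> borel_measurable (?Q (g1hat m tr) (g2hat m tr))" "\<And>w. F w \<le> 1" for F
      proof -
        have FB: "F \<in> borel_measurable borel" using F(1) by (simp cong: measurable_cong_sets)
        have "(\<integral>\<^sup>+w. F w \<partial>?Q (g1hat m tr) (g2hat m tr)) \<le> (\<integral>\<^sup>+w. F w \<partial>?Q g1s g2s)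
          + ennreal L * emeasure lborel (cball (0 :: 'x \<times> 'y) (2 * r))
          * (\<integral>\<^sup>+z. ennreal (norm ((g1hat m tr z - f1 z) - (g1s z - f1 z))) + ennreal (norm ((g2hat m tr z - f2 z) - (g2s z - f2 z))) \<partial>PZ)"
          by (rule nn_integral_shifted_noise_law_le[OF PZ(1) PN dens pd _ _ _ _ supp FB F(2)]) measurable
        also have "(\<integral>\<^sup>+z. ennreal (norm ((g1hat m tr z - f1 z) - (g1s z - f1 z))) + ennreal (norm ((g2hat m tr z - f2 z) - (g2s z - f2 z))) \<partial>PZ) =
          (\<integral>\<^sup>+z. ennreal (norm (g1hat m tr z - g1s z)) + ennreal (norm (g2hat m tr z - g2s z)) \<partial>PZ)"
          by simp
        also have "(\<integral>\<^sup>+w. F w \<partial>?Q g1s g2s) + ennreal L * emeasure lborel (cball (0 :: 'x \<times> 'y) (2 * r)) * \<dots> \<le>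
          (\<integral>\<^sup>+w. F w \<partial>?Q g1s g2s) + ennreal L * emeasure lborel (cball (0 :: 'x \<times> 'y) (2 * r)) * ennreal ((K1 + K2 + 2) / 2 * t)"
          by (intro add_left_mono mult_left_mono b) simp
        also have "emeasure lborel (cball (0 :: 'x \<times> 'y) (2 * r)) = ennreal (measure lborel (cball (0 :: 'x \<times> 'y) (2 * r)))"
          by (rule emeasure_eq_ennreal_measure) (use emeasure_lborel_cball_finite[of "0 :: 'x \<times> 'y" "2 * r"] in auto)
        also have "ennreal L * ennreal (measure lborel (cball (0 :: 'x \<times> 'y) (2 * r))) * ennreal ((K1 + K2 + 2) / 2 * t) = ennreal c"
          unfolding c_def ennreal_mult[OF mult_nonneg_nonneg[OF L0 measure_nonneg] Kt] ennreal_mult[OF L0 measure_nonneg] ..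
        finally show ?thesis .
      qed
      have "(\<integral>\<^sup>+R. ennreal (?r R) \<partial>PiM {..<n} (\<lambda>_. ?Q (g1hat m tr) (g2hat m tr))) \<le>
          (\<integral>\<^sup>+R. ennreal (?r R) \<partial>PiM {..<n} (\<lambda>_. ?Q g1s g2s)) + of_nat n * ennreal c"
        by (rule nn_integral_PiM_le[OF Qt Qs _ one])
          (use rm' in \<open>auto simp: resit_cond_reject_bounds\<close>)
      also have "\<dots> = ennreal (V + real n * c)"
        unfolding V using V0 c0 by (simp add: ennreal_of_nat_eq_real_of_nat flip: ennreal_mult ennreal_plus)
      also have "\<dots> \<le> ennreal (V + real n * c) + (indicator E1 tr + indicator E2 tr)"
        by simp
      finally show ?thesis unfolding eq by (simp add: add.assoc)
    qed
  qed
  have rej: "resit_rejection_prob n m B \<Psi> \<alpha> g1hat g2hat P =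
      (\<integral>d. ?r (resid_rows n (g1hat m (snd d)) (g2hat m (snd d)) (fst d)) \<partial>(Te \<Otimes>\<^sub>M Tr))"
    unfolding resit_rejection_prob_def resit_cond_reject_def Te_def Tr_def ..
  have dm: "(\<lambda>d. ?r (resid_rows n (g1hat m (snd d)) (g2hat m (snd d)) (fst d))) \<in> borel_measurable (Te \<Otimes>\<^sub>M Tr)"
    by (rule measurable_compose[OF resid rm])
  have "ennreal (resit_rejection_prob n m B \<Psi> \<alpha> g1hat g2hat P) =
      (\<integral>\<^sup>+d. ennreal (?r (resid_rows n (g1hat m (snd d)) (g2hat m (snd d)) (fst d))) \<partial>(Te \<Otimes>\<^sub>M Tr))"
    unfolding rej
    by (intro nn_integral_eq_integral[symmetric] prob_space_integrable_bounded TT.P.prob_space_axioms dm)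
      (auto simp: resit_cond_reject_bounds)
  \<comment> \<open>Test and training sets are independent, so conditioning on the training set
    means fixing \<open>tr\<close> in the outer integral.\<close>
  also have "\<dots> = (\<integral>\<^sup>+tr. \<integral>\<^sup>+te. ennreal (?r (resid_rows n (g1hat m tr) (g2hat m tr) te)) \<partial>Te \<partial>Tr)"
    using dm by (subst TT.nn_integral_snd[symmetric]) auto
  also have "\<dots> \<le> (\<integral>\<^sup>+tr. ennreal (V + real n * c) + indicator E1 tr + indicator E2 tr \<partial>Tr)"
    by (intro nn_integral_mono inner)
  also have "\<dots> = ennreal (V + real n * c) + emeasure Tr E1 + emeasure Tr E2"
    using E by (simp add: nn_integral_add Tr.emeasure_space_1)
  also have "\<dots> = ennreal (V + real n * c + measure Tr E1 + measure Tr E2)"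
    using V0 c0 by (simp add: Tr.emeasure_eq_measure flip: ennreal_plus)
  finally show ?thesis
    using V0 c0 by (subst (asm) ennreal_le_iff) (auto simp: V_def c_def Tr_def)
qed

section \<open>Passage to the limit, uniformly over the null distributions\<close>

theorem theorem4:
  fixes MZ :: "'z measure"
    and \<P>0 :: "'p set"
    and Zlaw :: "'p \<Rightarrow> 'z measure"
    and Nlaw :: "'p \<Rightarrow> ('x::euclidean_space \<times> 'y::euclidean_space) measure"
    and f1 g1s :: "'p \<Rightarrow> 'z \<Rightarrow> 'x"
    and f2 g2s :: "'p \<Rightarrow> 'z \<Rightarrow> 'y"
    and pd :: "'p \<Rightarrow> 'x \<times> 'y \<Rightarrow> real"
    and L :: real
    and A :: "('x \<times> 'y) set"
    and G1 :: "('z \<Rightarrow> 'x) set" and G2 :: "('z \<Rightarrow> 'y) set"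
    and g1hat :: "nat \<Rightarrow> (nat \<Rightarrow> 'x \<times> 'y \<times> 'z) \<Rightarrow> 'z \<Rightarrow> 'x"
    and g2hat :: "nat \<Rightarrow> (nat \<Rightarrow> 'x \<times> 'y \<times> 'z) \<Rightarrow> 'z \<Rightarrow> 'y"
    and \<gamma> :: real
    and nn :: "nat \<Rightarrow> nat"
    and \<Psi> :: "nat \<Rightarrow> (nat \<Rightarrow> 'x \<times> 'y) \<Rightarrow> real"
    and B :: nat
    and \<alpha> :: real
  assumes alpha: "0 < \<alpha>" "\<alpha> < 1"
    \<comment> \<open>additive noise model: Z ~ Zlaw p, (eps,eta) ~ Nlaw p independent of Z,
        X = f1 Z + eps, Y = f2 Z + eta, f_j(Z) = E[. | Z] (centred noise)\<close>
    and Z_law: "\<And>p. p \<in> \<P>0 \<Longrightarrow> prob_space (Zlaw p) \<and> sets (Zlaw p) = sets MZ"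
    and N_law: "\<And>p. p \<in> \<P>0 \<Longrightarrow> prob_space (Nlaw p)"
    and f_meas: "\<And>p. p \<in> \<P>0 \<Longrightarrow> f1 p \<in> borel_measurable MZ \<and> f2 p \<in> borel_measurable MZ"
    and centred: "\<And>p. p \<in> \<P>0 \<Longrightarrow>
        integrable (Nlaw p) fst \<and> (\<integral>v. fst v \<partial>Nlaw p) = 0 \<and>
        integrable (Nlaw p) snd \<and> (\<integral>v. snd v \<partial>Nlaw p) = 0"
    \<comment> \<open>H0 (X indep. of Y given Z), i.e. eps independent of eta\<close>
    and H0: "\<And>p. p \<in> \<P>0 \<Longrightarrow>
        Nlaw p = distr (Nlaw p) borel fst \<Otimes>\<^sub>M distr (Nlaw p) borel snd"
    \<comment> \<open>(S1)\<close>
    and gamma_pos: "\<gamma> > 0"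
    and gs_meas: "\<And>p. p \<in> \<P>0 \<Longrightarrow> g1s p \<in> borel_measurable MZ \<and> g2s p \<in> borel_measurable MZ"
    and ghat_meas: "\<And>m. (\<lambda>(tr, z). g1hat m tr z)
          \<in> borel_measurable (PiM {..<m} (\<lambda>_. borel \<Otimes>\<^sub>M borel \<Otimes>\<^sub>M MZ) \<Otimes>\<^sub>M MZ)"
        "\<And>m. (\<lambda>(tr, z). g2hat m tr z)
          \<in> borel_measurable (PiM {..<m} (\<lambda>_. borel \<Otimes>\<^sub>M borel \<Otimes>\<^sub>M MZ) \<Otimes>\<^sub>M MZ)"
    and S1_1: "\<And>e. e > 0 \<Longrightarrow> \<exists>M. \<forall>m\<ge>1. \<forall>p\<in>\<P>0.
        measure (PiM {..<m} (\<lambda>_. anm_law MZ (Zlaw p) (Nlaw p) (f1 p) (f2 p)))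
          {tr \<in> space (PiM {..<m} (\<lambda>_. anm_law MZ (Zlaw p) (Nlaw p) (f1 p) (f2 p))).
             (\<integral>\<^sup>+ z. ennreal ((norm (g1hat m tr z - g1s p z))\<^sup>2) \<partial>Zlaw p)
               > ennreal (M * real m powr (- \<gamma>))} < e"
    and S1_2: "\<And>e. e > 0 \<Longrightarrow> \<exists>M. \<forall>m\<ge>1. \<forall>p\<in>\<P>0.
        measure (PiM {..<m} (\<lambda>_. anm_law MZ (Zlaw p) (Nlaw p) (f1 p) (f2 p)))
          {tr \<in> space (PiM {..<m} (\<lambda>_. anm_law MZ (Zlaw p) (Nlaw p) (f1 p) (f2 p))).
             (\<integral>\<^sup>+ z. ennreal ((norm (g2hat m tr z - g2s p z))\<^sup>2) \<partial>Zlaw p)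
               > ennreal (M * real m powr (- \<gamma>))} < e"
    \<comment> \<open>(S2)\<close>
    and S2: "\<And>p. p \<in> \<P>0 \<Longrightarrow> pd p \<in> borel_measurable borel \<and> (\<forall>v. pd p v \<ge> 0) \<and>
        Nlaw p = density lborel (\<lambda>v. ennreal (pd p v)) \<and> L-lipschitz_on UNIV (pd p)"
    \<comment> \<open>(S3)\<close>
    and S3_A: "bounded A" "A \<in> sets borel"
    and S3_XY: "\<And>p. p \<in> \<P>0 \<Longrightarrow>
        AE d in anm_law MZ (Zlaw p) (Nlaw p) (f1 p) (f2 p). (fst d, fst (snd d)) \<in> A"
    and S3_classes: "\<And>m tr. g1hat m tr \<in> G1" "\<And>m tr. g2hat m tr \<in> G2"
    and S3_models: "\<And>p g1 g2. p \<in> \<P>0 \<Longrightarrow> g1 \<in> G1 \<Longrightarrow> g2 \<in> G2 \<Longrightarrow>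
        AE z in Zlaw p. (g1 z, g2 z) \<in> A"
    \<comment> \<open>sample sizes and test statistic\<close>
    and n_infty: "filterlim nn at_top sequentially"
    and n_small: "(\<lambda>m. real (nn m)) \<in> o(\<lambda>m. real m powr (\<gamma> / 2))"
    and Psi_meas: "\<And>n. \<Psi> n \<in> borel_measurable (PiM {..<n} (\<lambda>_. borel))"
  shows "limsup (\<lambda>m. SUP p\<in>\<P>0. ereal
           (resit_rejection_prob (nn m) m B \<Psi> \<alpha> g1hat g2hat
              (anm_law MZ (Zlaw p) (Nlaw p) (f1 p) (f2 p))
            - \<alpha>
            - min (tv_dist
                     (PiM {..<nn m} (\<lambda>_. shifted_noise_law (Zlaw p) (Nlaw p)
                        (\<lambda>z. g1s p z - f1 p z) (\<lambda>z. g2s p z - f2 p z)))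
                     (PiM {..<nn m} (\<lambda>_. shifted_noise_law (Zlaw p) (Nlaw p)
                        (\<lambda>z. 0) (\<lambda>z. g2s p z - f2 p z))))
                  (tv_dist
                     (PiM {..<nn m} (\<lambda>_. shifted_noise_law (Zlaw p) (Nlaw p)
                        (\<lambda>z. g1s p z - f1 p z) (\<lambda>z. g2s p z - f2 p z)))
                     (PiM {..<nn m} (\<lambda>_. shifted_noise_law (Zlaw p) (Nlaw p)
                        (\<lambda>z. g1s p z - f1 p z) (\<lambda>z. 0))))))
         \<le> 0"
proof -
  \<comment> \<open>The root of the rate in (S1): for m \<ge> 1 its square is that rate, and
    \<open>n_small\<close> says that \<open>real (nn m) * t m\<close> tends to 0.\<close>
  define t where "t m = real m powr (- \<gamma> / 2)" for m :: nat
  define X where "X m p =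
      resit_rejection_prob (nn m) m B \<Psi> \<alpha> g1hat g2hat (anm_law MZ (Zlaw p) (Nlaw p) (f1 p) (f2 p))
      - \<alpha>
      - min (tv_dist
               (PiM {..<nn m} (\<lambda>_. shifted_noise_law (Zlaw p) (Nlaw p)
                  (\<lambda>z. g1s p z - f1 p z) (\<lambda>z. g2s p z - f2 p z)))
               (PiM {..<nn m} (\<lambda>_. shifted_noise_law (Zlaw p) (Nlaw p)
                  (\<lambda>z. 0) (\<lambda>z. g2s p z - f2 p z))))
            (tv_dist
               (PiM {..<nn m} (\<lambda>_. shifted_noise_law (Zlaw p) (Nlaw p)
                  (\<lambda>z. g1s p z - f1 p z) (\<lambda>z. g2s p z - f2 p z)))
               (PiM {..<nn m} (\<lambda>_. shifted_noise_law (Zlaw p) (Nlaw p)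
                  (\<lambda>z. g1s p z - f1 p z) (\<lambda>z. 0))))" for m p
  obtain r where r: "norm a \<le> r" if "a \<in> A" for a
    using S3_A(1) by (auto simp: bounded_iff)
  \<comment> \<open>A bound at every sample size, not only in the limit. The null hypothesis enters
    here: with one component unshifted, the law of a row is a product and the test has level
    \<alpha>. Both routes are open, hence the minimum.\<close>
  have star: "(\<integral>R. resit_cond_reject n B (\<Psi> n) \<alpha> R
        \<partial>PiM {..<n} (\<lambda>_. shifted_noise_law (Zlaw p) (Nlaw p) (\<lambda>z. g1s p z - f1 p z) (\<lambda>z. g2s p z - f2 p z)))
      \<le> \<alpha> + min (tv_dist
               (PiM {..<n} (\<lambda>_. shifted_noise_law (Zlaw p) (Nlaw p) (\<lambda>z. g1s p z - f1 p z) (\<lambda>z. g2s p z - f2 p z)))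
               (PiM {..<n} (\<lambda>_. shifted_noise_law (Zlaw p) (Nlaw p) (\<lambda>z. 0) (\<lambda>z. g2s p z - f2 p z))))
            (tv_dist
               (PiM {..<n} (\<lambda>_. shifted_noise_law (Zlaw p) (Nlaw p) (\<lambda>z. g1s p z - f1 p z) (\<lambda>z. g2s p z - f2 p z)))
               (PiM {..<n} (\<lambda>_. shifted_noise_law (Zlaw p) (Nlaw p) (\<lambda>z. g1s p z - f1 p z) (\<lambda>z. 0))))"
    (is "?V \<le> \<alpha> + min (tv_dist ?M ?M1) (tv_dist ?M ?M2)") if p: "p \<in> \<P>0" for p n
  proof -
    have setsN: "sets (Nlaw p) = sets borel"
      using S2[OF p] by (metis sets_density sets_lborel)
    interpret PZ: prob_space "Zlaw p" using Z_law[OF p] by simp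
    interpret PN: prob_space "Nlaw p" by (rule N_law[OF p])
    define N1 where "N1 = distr (Nlaw p) borel fst"
    define N2 where "N2 = distr (Nlaw p) borel snd"
    have "fst \<in> borel_measurable (Nlaw p)" "snd \<in> borel_measurable (Nlaw p)"
      using borel_measurable_fst_snd setsN by (simp_all cong: measurable_cong_sets)
    then have N12: "prob_space N1" "sets N1 = sets borel" "prob_space N2" "sets N2 = sets borel"
      unfolding N1_def N2_def by (auto intro!: PN.prob_space_distr)
    have NN: "Nlaw p = N1 \<Otimes>\<^sub>M N2" unfolding N1_def N2_def by (rule H0[OF p])
    have [measurable]: "f1 p \<in> borel_measurable (Zlaw p)" "f2 p \<in> borel_measurable (Zlaw p)"
      "g1s p \<in> borel_measurable (Zlaw p)" "g2s p \<in> borel_measurable (Zlaw p)"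
      using f_meas[OF p] gs_meas[OF p] Z_law[OF p] by (simp_all cong: measurable_cong_sets)
    have d: "(\<lambda>z. g1s p z - f1 p z) \<in> borel_measurable (Zlaw p)" "(\<lambda>z. g2s p z - f2 p z) \<in> borel_measurable (Zlaw p)"
      by measurable
    have law: "prob_space (PiM {..<n} (\<lambda>_. shifted_noise_law (Zlaw p) (Nlaw p) u1 u2))"
      "sets (PiM {..<n} (\<lambda>_. shifted_noise_law (Zlaw p) (Nlaw p) u1 u2)) = sets (PiM {..<n} (\<lambda>_. borel))"
      if "u1 \<in> borel_measurable (Zlaw p)" "u2 \<in> borel_measurable (Zlaw p)" for u1 u2
    proof -
      show "prob_space (PiM {..<n} (\<lambda>_. shifted_noise_law (Zlaw p) (Nlaw p) u1 u2))"
        by (intro prob_space_PiM prob_space_shifted_noise_law PZ.prob_space_axioms PN.prob_space_axioms setsN that)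
      show "sets (PiM {..<n} (\<lambda>_. shifted_noise_law (Zlaw p) (Nlaw p) u1 u2)) = sets (PiM {..<n} (\<lambda>_. borel))"
        by (rule sets_PiM_cong) simp_all
    qed
    have zero: "(\<lambda>z. 0) \<in> borel_measurable (Zlaw p)" by simp
    interpret Z1: pair_prob_space "Zlaw p" N1
      using N12 PZ.prob_space_axioms by (simp add: pair_prob_space_def pair_sigma_finite_def prob_space_imp_sigma_finite)
    interpret Z2: pair_prob_space "Zlaw p" N2
      using N12 PZ.prob_space_axioms by (simp add: pair_prob_space_def pair_sigma_finite_def prob_space_imp_sigma_finite)
    note [measurable_cong] = N12(2,4)
    note prod = shifted_noise_law_eq_product[OF PZ.prob_space_axioms N12 d]
    have "(\<integral>R. resit_cond_reject n B (\<Psi> n) \<alpha> R \<partial>?M1) \<le> \<alpha>"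
      unfolding NN prod(1)
      using alpha(1) by (intro integral_resit_cond_reject_le_alpha Psi_meas N12 Z2.P.prob_space_distr) auto
    moreover have "?V \<le> (\<integral>R. resit_cond_reject n B (\<Psi> n) \<alpha> R \<partial>?M1) + tv_dist ?M ?M1"
      by (intro integral_resit_cond_reject_le_tv Psi_meas law d zero)
    moreover have "(\<integral>R. resit_cond_reject n B (\<Psi> n) \<alpha> R \<partial>?M2) \<le> \<alpha>"
      unfolding NN prod(2)
      using alpha(1) by (intro integral_resit_cond_reject_le_alpha Psi_meas N12 Z1.P.prob_space_distr) auto
    moreover have "?V \<le> (\<integral>R. resit_cond_reject n B (\<Psi> n) \<alpha> R \<partial>?M2) + tv_dist ?M ?M2"
      by (intro integral_resit_cond_reject_le_tv Psi_meas law d zero)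
    ultimately show ?thesis by linarith
  qed
  \<comment> \<open>The allowance e is split into e / 4 for each of the two sets of bad training
    sets and e / 2 for the accumulated error of the rows.\<close>
  have "limsup (\<lambda>m. SUP p\<in>\<P>0. ereal (X m p)) \<le> 0 + ereal e" if e: "e > 0" for e :: real
  proof -
    obtain M1 where M1: "\<And>m p. m \<ge> 1 \<Longrightarrow> p \<in> \<P>0 \<Longrightarrow>
        measure (PiM {..<m} (\<lambda>_. anm_law MZ (Zlaw p) (Nlaw p) (f1 p) (f2 p)))
          {tr \<in> space (PiM {..<m} (\<lambda>_. anm_law MZ (Zlaw p) (Nlaw p) (f1 p) (f2 p))).
             (\<integral>\<^sup>+ z. ennreal ((norm (g1hat m tr z - g1s p z))\<^sup>2) \<partial>Zlaw p)
               > ennreal (M1 * real m powr (- \<gamma>))} < e / 4"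
      using S1_1[of "e / 4"] e by auto
    obtain M2 where M2: "\<And>m p. m \<ge> 1 \<Longrightarrow> p \<in> \<P>0 \<Longrightarrow>
        measure (PiM {..<m} (\<lambda>_. anm_law MZ (Zlaw p) (Nlaw p) (f1 p) (f2 p)))
          {tr \<in> space (PiM {..<m} (\<lambda>_. anm_law MZ (Zlaw p) (Nlaw p) (f1 p) (f2 p))).
             (\<integral>\<^sup>+ z. ennreal ((norm (g2hat m tr z - g2s p z))\<^sup>2) \<partial>Zlaw p)
               > ennreal (M2 * real m powr (- \<gamma>))} < e / 4"
      using S1_2[of "e / 4"] e by auto
    \<comment> \<open>(S1) may supply negative constants, whereas
      \<open>resit_rejection_prob_le\<close> takes nonnegative ones. Truncation at 0 leaves the
      thresholds unchanged, since \<open>ennreal\<close> sends negative reals to 0; this is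
      \<open>M0\<close> below.\<close>
    define C where "C = L * measure lborel (cball (0 :: 'x \<times> 'y) (2 * r)) * ((max M1 0 + max M2 0 + 2) / 2)"
    have "(\<lambda>m. real (nn m) / (real m powr (\<gamma> / 2))) \<longlonglongrightarrow> 0"
      using smalloD_tendsto[OF n_small] .
    then have "(\<lambda>m. C * (real (nn m) / (real m powr (\<gamma> / 2)))) \<longlonglongrightarrow> C * 0"
      by (intro tendsto_mult tendsto_const)
    then have "\<forall>\<^sub>F m in sequentially. C * (real (nn m) / (real m powr (\<gamma> / 2))) < e / 2"
      using e by (intro order_tendstoD(2)) auto
    \<comment> \<open>Neither \<open>C\<close> nor the condition on m mentions p, so one threshold
      for m serves all distributions. The restriction to m \<ge> 1 is that of (S1) and also makes
      \<open>t m\<close> positive, as \<open>0 powr x\<close> is 0.\<close>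
    then have "\<forall>\<^sub>F m in sequentially. (SUP p\<in>\<P>0. ereal (X m p)) \<le> ereal e"
      using eventually_ge_at_top[of 1]
    proof eventually_elim
      case (elim m)
      show ?case
      proof (rule SUP_least)
        fix p assume p: "p \<in> \<P>0"
        let ?P = "anm_law MZ (Zlaw p) (Nlaw p) (f1 p) (f2 p)"
        have t: "t m > 0" "(t m)\<^sup>2 = real m powr (- \<gamma>)" "t m = 1 / (real m powr (\<gamma> / 2))"
          using elim(2) by (simp_all add: t_def power2_eq_square powr_minus_divide flip: powr_add)
        let ?E1 = "{tr \<in> space (PiM {..<m} (\<lambda>_. ?P)). (\<integral>\<^sup>+z. ennreal ((norm (g1hat m tr z - g1s p z))\<^sup>2) \<partial>Zlaw p) > ennreal (max M1 0 * (t m)\<^sup>2)}"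
        let ?E2 = "{tr \<in> space (PiM {..<m} (\<lambda>_. ?P)). (\<integral>\<^sup>+z. ennreal ((norm (g2hat m tr z - g2s p z))\<^sup>2) \<partial>Zlaw p) > ennreal (max M2 0 * (t m)\<^sup>2)}"
        have M0: "ennreal (max M 0 * real m powr (- \<gamma>)) = ennreal (M * real m powr (- \<gamma>))" for M
          by (cases "M \<ge> 0") (auto simp: max_def ennreal_neg mult_nonpos_nonneg)
        have small: "measure (PiM {..<m} (\<lambda>_. ?P)) ?E1 < e / 4" "measure (PiM {..<m} (\<lambda>_. ?P)) ?E2 < e / 4"
          using M1[OF elim(2) p] M2[OF elim(2) p] unfolding t(2) M0 by auto
        have "resit_rejection_prob (nn m) m B \<Psi> \<alpha> g1hat g2hat ?P \<le>
            (\<integral>R. resit_cond_reject (nn m) B (\<Psi> (nn m)) \<alpha> R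
              \<partial>PiM {..<nn m} (\<lambda>_. shifted_noise_law (Zlaw p) (Nlaw p) (\<lambda>z. g1s p z - f1 p z) (\<lambda>z. g2s p z - f2 p z)))
          + real (nn m) * (L * measure lborel (cball (0 :: 'x \<times> 'y) (2 * r)) * ((max M1 0 + max M2 0 + 2) / 2 * t m))
          + measure (PiM {..<m} (\<lambda>_. ?P)) ?E1 + measure (PiM {..<m} (\<lambda>_. ?P)) ?E2"
          using Z_law[OF p] N_law[OF p] S2[OF p] f_meas[OF p] gs_meas[OF p]
          by (intro resit_rejection_prob_le[where pd = "pd p" and A = A] ghat_meas S3_A(2) r S3_XY[OF p]
              S3_models[OF p] S3_classes Psi_meas t(1)) auto
        also have "real (nn m) * (L * measure lborel (cball (0 :: 'x \<times> 'y) (2 * r)) * ((max M1 0 + max M2 0 + 2) / 2 * t m))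
            = C * (real (nn m) / (real m powr (\<gamma> / 2)))"
          by (simp add: C_def t(3))
        finally show "ereal (X m p) \<le> ereal e"
          using star[OF p, of "nn m"] small elim(1) by (simp add: X_def)
      qed
    qed
    then show ?thesis unfolding add_0_left by (rule Limsup_bounded)
  qed
  then have "limsup (\<lambda>m. SUP p\<in>\<P>0. ereal (X m p)) \<le> 0"
    by (rule ereal_le_epsilon2)
  then show ?thesis by (simp only: X_def)
qed

end
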